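(* There exist uncountably many pairwise non-conjugate crooked maps $f\colon I\to I$ with topological entropy $0$ and exactly two fixed points.
   Context: $I=[0,1]$. A map $f\colon I\to I$ is a continuous surjective function. Maps $f,g\colon I\to I$ are conjugate if there is a homeomorphism $h\colon I\to I$ with $g=h\circ f\circ h^{-1}$. Topological entropy is the standard one for continuous self-maps of compact metric spaces. For $a,b\in I$ and $\delta>0$, a map $f$ is $\delta$-crooked between $a$ and $b$ if for every two points $c,d\in I$ with $f(c)=a$ and $f(d)=b$ there is a point $c'$ between $c$ and $d$ and a point $d'$ between $c'$ and $d$ such that $|b-f(c')|<\delta$ and $|a-f(d')|<\delta$ ("between" allows endpoints). The map $f$ is $\delta$-crooked if it is $\delta$-crooked between every pair of points of $I$. The map $f$ is crooked if for every $\delta>0$ there exists $n\in\mathbb N$ such that $f^n$ is $\delta$-crooked. *)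

theory Defs
  imports "HOL-Analysis.Analysis"
begin

abbreviation I01 :: "real set" where
  "I01 \<equiv> {0..1}"

text \<open>
  Self-maps of a set \<open>X\<close> are total functions on the ambient type of which only the values
  on \<open>X\<close> matter; none of the notions below depends on the values outside \<open>X\<close>.
\<close>

definition interval_map :: "(real \<Rightarrow> real) \<Rightarrow> bool" where
  "interval_map f \<longleftrightarrow> continuous_on I01 f \<and> f ` I01 = I01"

text \<open>In particular, two functions that agree on \<open>X\<close> are conjugate on \<open>X\<close>.\<close>

definition conjugate_on :: "'a::topological_space set \<Rightarrow> ('a \<Rightarrow> 'a) \<Rightarrow> ('a \<Rightarrow> 'a) \<Rightarrow> bool" where
  "conjugate_on X f g \<longleftrightarrow>
     (\<exists>h h'. homeomorphism X X h h' \<and> (\<forall>x\<in>X. g x = h (f (h' x))))"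

definition crooked_between :: "real \<Rightarrow> (real \<Rightarrow> real) \<Rightarrow> real \<Rightarrow> real \<Rightarrow> bool" where
  "crooked_between \<delta> f a b \<longleftrightarrow>
     (\<forall>c\<in>I01. \<forall>d\<in>I01. f c = a \<longrightarrow> f d = b \<longrightarrow>
        (\<exists>c'\<in>closed_segment c d. \<exists>d'\<in>closed_segment c' d.
           \<bar>b - f c'\<bar> < \<delta> \<and> \<bar>a - f d'\<bar> < \<delta>))"

definition delta_crooked :: "real \<Rightarrow> (real \<Rightarrow> real) \<Rightarrow> bool" where
  "delta_crooked \<delta> f \<longleftrightarrow> (\<forall>a\<in>I01. \<forall>b\<in>I01. crooked_between \<delta> f a b)"

definition crooked :: "(real \<Rightarrow> real) \<Rightarrow> bool" where
  "crooked f \<longleftrightarrow> (\<forall>\<delta>>0. \<exists>n. delta_crooked \<delta> (f ^^ n))"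

text \<open>
  Topological entropy is defined by Bowen's spanning sets. A set \<open>E\<close> is
  \<open>(n, \<epsilon>)\<close>-spanning if every point of \<open>X\<close> is \<open>\<epsilon>\<close>-close to a point of \<open>E\<close> in the metric
  \<open>max {dist (f\<^sup>i x) (f\<^sup>i y) | i < n}\<close>. For compact \<open>X\<close> and continuous \<open>f\<close> mapping \<open>X\<close> to itself,
  finite spanning sets exist, so the infimum below is a minimum (on \<open>nat\<close>, the infimum of
  the empty set would be the junk value 0). The growth rate is monotone in \<open>\<epsilon>\<close>, so its
  limit for \<open>\<epsilon>\<close> tending to 0 is the supremum over all \<open>\<epsilon> > 0\<close>.
\<close>

definition spanning :: "'a::metric_space set \<Rightarrow> ('a \<Rightarrow> 'a) \<Rightarrow> nat \<Rightarrow> real \<Rightarrow> 'a set \<Rightarrow> bool" where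
  "spanning X f n \<epsilon> E \<longleftrightarrow>
     E \<subseteq> X \<and> (\<forall>x\<in>X. \<exists>y\<in>E. \<forall>i<n. dist ((f ^^ i) x) ((f ^^ i) y) < \<epsilon>)"

definition spanning_number :: "'a::metric_space set \<Rightarrow> ('a \<Rightarrow> 'a) \<Rightarrow> nat \<Rightarrow> real \<Rightarrow> nat" where
  "spanning_number X f n \<epsilon> = Inf {card E | E. finite E \<and> spanning X f n \<epsilon> E}"

definition top_entropy :: "'a::metric_space set \<Rightarrow> ('a \<Rightarrow> 'a) \<Rightarrow> ereal" where
  "top_entropy X f =
     (SUP \<epsilon>\<in>{0<..}. limsup (\<lambda>n. ereal (ln (real (spanning_number X f n \<epsilon>)) / real n)))"

end

theory Submission
  imports Defs "HOL-Real_Asymp.Real_Asymp"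
begin

text \<open>
  All maps constructed here satisfy \<open>f x < x\<close> on the open interval, so that the fixed points are
  0 and 1 and every orbit spends a bounded time away from them; this forces entropy 0.

  The open interval is identified with the real line, where \<open>f\<close> becomes a perturbation \<open>F\<close> of
  \<open>t \<mapsto> t - 1\<close> that differs from it only on a sparse sequence of unit blocks going to infinity.
  On the block starting at \<open>X\<close>, \<open>F t + 1\<close> is a self-map of the block. A point coming from far above
  passes through every block exactly once, at a phase that is determined by its position modulo 1.
  Hence a high iterate of \<open>F\<close> is, up to a translation, a composition of lifts of degree one circle
  maps, each of which fixes a point modulo 1. Two ideas show that such compositions can be
  \<open>\<epsilon>\<close>-crooked on arbitrarily long intervals: composing with crooked self-maps of unit intervals
  increases the width of the image of a unit interval without bound, and if two successive crooked
  factors are cut at points whose values are far apart, then a pair of points for which crookedness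
  fails would have to straddle both cut values at once. Since crookedness survives composition on
  either side, one such group of blocks block_map \<open>\<epsilon>\<close>, placed after all earlier blocks, suffices.

  To get uncountably many conjugacy classes, one more block is inserted before every group, with a
  profile that is constant on an interval, while all other profiles are nowhere locally constant.
  The level sets of \<open>f\<close> containing an interval are thereby enumerated in increasing order,
  and whether the \<open>n\<close>-th one is connected is a conjugacy invariant that can be prescribed.
\<close>

section \<open>Crooked pairs and crooked paths\<close>

text \<open>Crookedness is attached to a pair of points instead of a pair of values: in this form it
  can be carried along compositions and applied to maps of the whole line.\<close>

definition crooked_pair :: "real \<Rightarrow> (real \<Rightarrow> real) \<Rightarrow> real \<Rightarrow> real \<Rightarrow> bool" where
  "crooked_pair e f c d \<longleftrightarrow> (\<exists>c'\<in>closed_segment c d. \<exists>d'\<in>closed_segment c' d.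
     \<bar>f d - f c'\<bar> < e \<and> \<bar>f c - f d'\<bar> < e)"

lemma crooked_between_iff_crooked_pair:
  "crooked_between e f a b \<longleftrightarrow> (\<forall>c\<in>I01. \<forall>d\<in>I01. f c = a \<longrightarrow> f d = b \<longrightarrow> crooked_pair e f c d)"
  unfolding crooked_between_def crooked_pair_def by blast

text \<open>The same two intermediate points serve in exchanged roles when the segment is run
  backwards.\<close>

lemma crooked_pair_sym:
  assumes "crooked_pair e f c d" shows "crooked_pair e f d c"
proof -
  obtain c' d' where *: "c' \<in> closed_segment c d" "d' \<in> closed_segment c' d"
    "\<bar>f d - f c'\<bar> < e" "\<bar>f c - f d'\<bar> < e"
    using assms unfolding crooked_pair_def by blast
  have "d' \<in> closed_segment d c" "c' \<in> closed_segment d' c"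
    using *(1,2) by (auto simp: closed_segment_eq_real_ivl split: if_splits)
  then show ?thesis using *(3,4) unfolding crooked_pair_def by blast
qed

lemma crooked_pair_ordered:
  assumes "crooked_pair e f c d" "c \<le> d"
  obtains c' d' where "c \<le> c'" "c' \<le> d'" "d' \<le> d" "\<bar>f d - f c'\<bar> < e" "\<bar>f c - f d'\<bar> < e"
  using assms unfolding crooked_pair_def by (auto simp: closed_segment_eq_real_ivl split: if_splits)

lemma crkI_ordered:
  assumes "c \<le> c'" "c' \<le> d'" "d' \<le> d" "\<bar>f d - f c'\<bar> < e" "\<bar>f c - f d'\<bar> < e"
  shows "crooked_pair e f c d"
  unfolding crooked_pair_def using assms
  by (intro bexI[of _ c'] bexI[of _ d']) (auto simp: closed_segment_eq_real_ivl)

lemma crooked_pair_near: "\<bar>f c - f d\<bar> < e \<Longrightarrow> crooked_pair e f c d"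
  unfolding crooked_pair_def by (intro bexI[of _ c] bexI[of _ d]) (auto simp: abs_minus_commute)

lemma subset_closed_segment_real:
  fixes c d :: real
  assumes "x \<in> closed_segment c d" shows "closed_segment x d \<subseteq> closed_segment c d"
  using assms by (auto simp: closed_segment_eq_real_ivl split: if_splits)

text \<open>The intermediate value theorem lifts the two intermediate points one after the other,
  the second one on the part of the segment that remains after the first.\<close>

lemma crooked_pair_comp_right:
  assumes cont: "continuous_on (closed_segment c d) \<psi>" and "crooked_pair e f (\<psi> c) (\<psi> d)"
  shows "crooked_pair e (f \<circ> \<psi>) c d"
proof -
  obtain u v where *: "u \<in> closed_segment (\<psi> c) (\<psi> d)" "v \<in> closed_segment u (\<psi> d)"
    "\<bar>f (\<psi> d) - f u\<bar> < e" "\<bar>f (\<psi> c) - f v\<bar> < e"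
    using assms(2) unfolding crooked_pair_def by blast
  obtain x where x: "x \<in> closed_segment c d" "\<psi> x = u"
    using IVT'_closed_segment_real[of u \<psi> c d] *(1) cont by blast
  note sub = subset_closed_segment_real[OF x(1)]
  obtain y where y: "y \<in> closed_segment x d" "\<psi> y = v"
    using IVT'_closed_segment_real[of v \<psi> x d] *(2) x(2) continuous_on_subset[OF cont sub] by blast
  show ?thesis unfolding crooked_pair_def using x y *(3,4) by auto
qed

text \<open>The intermediate points stay the same; continuity of an outer map enters only as a
  modulus at the two end values.\<close>

lemma crooked_pair_comp_left:
  assumes "crooked_pair g f c d"
    and "\<And>t. t \<in> closed_segment c d \<Longrightarrow> \<bar>f d - f t\<bar> < g \<Longrightarrow> \<bar>k d - k t\<bar> < e"
    and "\<And>t. t \<in> closed_segment c d \<Longrightarrow> \<bar>f c - f t\<bar> < g \<Longrightarrow> \<bar>k c - k t\<bar> < e"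
  shows "crooked_pair e k c d"
proof -
  obtain u v where *: "u \<in> closed_segment c d" "v \<in> closed_segment u d"
    "\<bar>f d - f u\<bar> < g" "\<bar>f c - f v\<bar> < g"
    using assms(1) unfolding crooked_pair_def by blast
  have "v \<in> closed_segment c d" using *(1,2) subset_closed_segment_real by blast
  then show ?thesis using * assms(2,3) unfolding crooked_pair_def by blast
qed

text \<open>Moving the ends outwards changes each target value by at most \<open>r\<close>.\<close>

lemma crooked_pair_extend:
  assumes "c1 \<in> closed_segment c d" "d1 \<in> closed_segment c1 d"
    and "\<bar>f c1 - f c\<bar> \<le> r" "\<bar>f d1 - f d\<bar> \<le> r" "crooked_pair e f c1 d1"
  shows "crooked_pair (e + r) f c d"
proof -
  obtain u v where *: "u \<in> closed_segment c1 d1" "v \<in> closed_segment u d1"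
    "\<bar>f d1 - f u\<bar> < e" "\<bar>f c1 - f v\<bar> < e"
    using assms(5) unfolding crooked_pair_def by blast
  have "u \<in> closed_segment c d" "v \<in> closed_segment u d"
    using *(1,2) assms(1,2) by (auto simp: closed_segment_eq_real_ivl split: if_splits)
  moreover have "\<bar>f d - f u\<bar> < e + r" "\<bar>f c - f v\<bar> < e + r"
    using *(3,4) assms(3,4) by linarith+
  ultimately show ?thesis unfolding crooked_pair_def by blast
qed

text \<open>If \<open>f d\<close> lies on the way from \<open>f c\<close> to \<open>f u\<close>, it
  is taken before \<open>u\<close> and hence before \<open>v\<close>; otherwise it lies between
  \<open>f u\<close> and \<open>f m\<close>, so that \<open>u\<close> is already close
  enough.\<close>

lemma crooked_pair_cut:
  assumes cont: "continuous_on (closed_segment c d) f" and m: "m \<in> closed_segment c d"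
    and crooked_pair: "crooked_pair e f c m" and btw: "f d \<in> closed_segment (f c) (f m)"
  shows "crooked_pair e f c d"
proof -
  obtain u v where *: "u \<in> closed_segment c m" "v \<in> closed_segment u m"
    "\<bar>f m - f u\<bar> < e" "\<bar>f c - f v\<bar> < e"
    using crooked_pair unfolding crooked_pair_def by blast
  have seg: "u \<in> closed_segment c d" "v \<in> closed_segment u d"
    using *(1,2) m by (auto simp: closed_segment_eq_real_ivl split: if_splits)
  show ?thesis
  proof (cases "f d \<in> closed_segment (f c) (f u)")
    case True
    have "continuous_on (closed_segment c u) f"
      using continuous_on_subset[OF cont] seg(1) by (auto simp: closed_segment_eq_real_ivl split: if_splits)
    then obtain w where w: "w \<in> closed_segment c u" "f w = f d"
      using IVT'_closed_segment_real[of "f d" f c u] True by blast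
    have "w \<in> closed_segment c d" "v \<in> closed_segment w d"
      using w seg by (auto simp: closed_segment_eq_real_ivl split: if_splits)
    moreover have "\<bar>f d - f w\<bar> < e" using w *(3) by auto
    ultimately show ?thesis unfolding crooked_pair_def using *(4) by blast
  next
    case False
    then have "\<bar>f d - f u\<bar> < e"
      using btw *(3) by (auto simp: closed_segment_eq_real_ivl split: if_splits)
    then show ?thesis unfolding crooked_pair_def using seg *(4) by blast
  qed
qed

lemma crooked_pair_cut':
  assumes cont: "continuous_on (closed_segment c d) f" and m: "m \<in> closed_segment c d"
    and crooked_pair: "crooked_pair e f m d" and btw: "f c \<in> closed_segment (f d) (f m)"
  shows "crooked_pair e f c d"
proof (rule crooked_pair_sym, rule crooked_pair_cut)
  show "continuous_on (closed_segment d c) f" using cont by (simp add: closed_segment_commute)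
  show "m \<in> closed_segment d c" using m by (simp add: closed_segment_commute)
qed (use crooked_pair btw crooked_pair_sym in auto)

section \<open>Crooked climbing paths and crooked self-maps of the unit interval\<close>

definition nonflat :: "real \<Rightarrow> (real \<Rightarrow> real) \<Rightarrow> bool" where
  "nonflat r g \<longleftrightarrow> (\<forall>u v. 0 \<le> u \<longrightarrow> u < v \<longrightarrow> v \<le> r \<longrightarrow> (\<exists>w\<in>{u..v}. g w \<noteq> g u))"

lemma nonflat_obtain_less:
  assumes "nonflat r g" "0 \<le> u" "u < v" "v \<le> r"
  obtains s t where "s \<in> {u..v}" "t \<in> {u..v}" "g s \<noteq> g t"
  using assms unfolding nonflat_def by (meson atLeastAtMost_iff less_imp_le order_refl)

lemma nonflatI:
  assumes "\<And>u v. 0 \<le> u \<Longrightarrow> u < v \<Longrightarrow> v \<le> r \<Longrightarrow> \<exists>s\<in>{u..v}. \<exists>t\<in>{u..v}. g s \<noteq> g t"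
  shows "nonflat r g"
  unfolding nonflat_def by (metis assms)

text \<open>A climb to height \<open>k\<close> that is crooked at the fixed scale 3; after division
  by the height the scale becomes \<open>3 / k\<close>. The constant values outside
  \<open>{0..r}\<close> make sums of shifted copies into concatenations.\<close>

definition crooked_path :: "real \<Rightarrow> real \<Rightarrow> (real \<Rightarrow> real) \<Rightarrow> bool" where
  "crooked_path k r g \<longleftrightarrow> 0 < r \<and> continuous_on UNIV g \<and> (\<forall>u\<le>0. g u = 0) \<and> (\<forall>u\<ge>r. g u = k) \<and>
     (\<forall>u. g u \<in> {0..k}) \<and> (\<forall>c\<in>{0..r}. \<forall>d\<in>{0..r}. crooked_pair 3 g c d) \<and> nonflat r g"

lemma crooked_pair_affine:
  assumes "crooked_pair e g (c - s) (d - s)" "\<And>t. t \<in> closed_segment c d \<Longrightarrow> f t = a + l * g (t - s)" "\<bar>l\<bar> \<le> 1"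
  shows "crooked_pair e f c d"
proof -
  have 1: "crooked_pair e (g \<circ> (\<lambda>t. t - s)) c d"
    by (rule crooked_pair_comp_right) (auto intro!: continuous_intros assms)
  have 2: "\<bar>f x - f t\<bar> < e" if "\<bar>g (x - s) - g (t - s)\<bar> < e" "x \<in> closed_segment c d" "t \<in> closed_segment c d" for x t
  proof -
    have "\<bar>f x - f t\<bar> = \<bar>l\<bar> * \<bar>g (x - s) - g (t - s)\<bar>"
      using assms(2) that by (simp add: abs_mult[symmetric] algebra_simps)
    also have "\<dots> \<le> 1 * \<bar>g (x - s) - g (t - s)\<bar>" by (intro mult_right_mono assms) auto
    finally show ?thesis using that by simp
  qed
  show ?thesis by (rule crooked_pair_comp_left[OF 1]) (auto intro: 2)
qed

text \<open>A pair with one point on each rising piece is served by the descending piece between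
  them, which takes all heights from \<open>k\<close> down to 1. A pair on adjacent pieces is cut at
  the turning point between them.\<close>

lemma crooked_path_Suc:
  assumes k: "2 \<le> k" and g: "crooked_path k r g"
  shows "\<exists>r' g'. crooked_path (k + 1) r' g'"
proof -
  \<comment> \<open>The descent has height \<open>k - 1\<close>; a factor at most 1 keeps the scale
    3.\<close>
  define l where "l = (k - 1) / k"
  have l: "0 < l" "l \<le> 1" "l * k = k - 1" using k by (auto simp: l_def field_simps)
  \<comment> \<open>\<open>f\<close> runs from 0 up to \<open>k\<close>, back to 1, and up to \<open>k + 1\<close>.\<close>
  define f where "f u = g u - l * g (u - r) + g (u - 2 * r)" for u
  have r: "0 < r" and gc: "continuous_on UNIV g" and g0: "\<And>u. u \<le> 0 \<Longrightarrow> g u = 0"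
    and g1: "\<And>u. u \<ge> r \<Longrightarrow> g u = k" and gr: "\<And>u. 0 \<le> g u" "\<And>u. g u \<le> k"
    and gk: "\<And>c d. c \<in> {0..r} \<Longrightarrow> d \<in> {0..r} \<Longrightarrow> crooked_pair 3 g c d" and gn: "nonflat r g"
    using g unfolding crooked_path_def by (blast | force)+
  have f1: "f u = g u" if "u \<le> r" for u using that r g0 by (simp add: f_def)
  have f2: "f u = k - l * g (u - r)" if "r \<le> u" "u \<le> 2 * r" for u using that g0 g1 by (simp add: f_def)
  have f3: "f u = 1 + g (u - 2 * r)" if "2 * r \<le> u" for u using that g1 r l(3) by (simp add: f_def)
  have gl: "0 \<le> l * g u" "l * g u \<le> k - 1" for u
    using gr[of u] l mult_left_mono[of "g u" k l] by auto
  have r2: "f u \<in> {1..k}" if "r \<le> u" "u \<le> 2 * r" for u using f2[OF that] gl[of "u - r"] by auto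
  have r1: "f u \<in> {0..k}" if "u \<le> r" for u using f1[OF that] gr[of "u"] by auto
  have r3: "f u \<in> {1..k+1}" if "2 * r \<le> u" for u using f3[OF that] gr[of "u - 2 * r"] by auto
  have cont: "continuous_on A f" for A
  proof -
    have "continuous_on A (\<lambda>u. g (u - s))" for s
      by (rule continuous_on_compose2[OF gc]) (auto intro!: continuous_intros)
    from this[of 0] this[of r] this[of "2 * r"] show ?thesis
      unfolding f_def by (auto intro!: continuous_intros)
  qed
  have c1: "crooked_pair 3 f c d" if "c \<in> {0..r}" "d \<in> {0..r}" for c d
  proof (rule crooked_pair_affine[where g = g and s = 0 and a = 0 and l = 1])
    show "f t = 0 + 1 * g (t - 0)" if "t \<in> closed_segment c d" for t
      using that \<open>c \<in> _\<close> \<open>d \<in> _\<close> by (subst f1) (auto simp: closed_segment_eq_real_ivl split: if_splits)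
  qed (use gk that in auto)
  have c2: "crooked_pair 3 f c d" if "c \<in> {r..2*r}" "d \<in> {r..2*r}" for c d
  proof (rule crooked_pair_affine[where g = g and s = r and a = k and l = "- l"])
    show "f t = k + - l * g (t - r)" if "t \<in> closed_segment c d" for t
      using that \<open>c \<in> _\<close> \<open>d \<in> _\<close> by (subst f2) (auto simp: closed_segment_eq_real_ivl split: if_splits)
  qed (use gk that l in auto)
  have c3: "crooked_pair 3 f c d" if "c \<in> {2*r..3*r}" "d \<in> {2*r..3*r}" for c d
  proof (rule crooked_pair_affine[where g = g and s = "2*r" and a = 1 and l = 1])
    show "f t = 1 + 1 * g (t - 2 * r)" if "t \<in> closed_segment c d" for t
      using that \<open>c \<in> _\<close> \<open>d \<in> _\<close> by (subst f3) (auto simp: closed_segment_eq_real_ivl split: if_splits)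
  qed (use gk that in auto)
  have fr: "f r = k" using f1[of r] g1[of r] by simp
  have f2r: "f (2*r) = 1" using f3[of "2*r"] g0[of 0] by simp
  have c12: "crooked_pair 3 f c d" if "c \<in> {0..r}" "d \<in> {r..2*r}" for c d
  proof (cases "f c \<le> f d")
    case True
    show ?thesis
      by (rule crooked_pair_cut[where m = r, OF cont])
        (use that True r1[of c] r2[of d] r fr c1[of c r] in \<open>auto simp: closed_segment_eq_real_ivl\<close>)
  next
    case False
    show ?thesis
      by (rule crooked_pair_cut'[where m = r, OF cont])
        (use that False r1[of c] r2[of d] r fr c2[of r d] in \<open>auto simp: closed_segment_eq_real_ivl\<close>)
  qed
  have c23: "crooked_pair 3 f c d" if "c \<in> {r..2*r}" "d \<in> {2*r..3*r}" for c d
  proof (cases "f c \<le> f d")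
    case True
    show ?thesis
      by (rule crooked_pair_cut'[where m = "2*r", OF cont])
        (use that True r2[of c] r3[of d] r f2r c3[of "2*r" d] in \<open>auto simp: closed_segment_eq_real_ivl\<close>)
  next
    case False
    show ?thesis
      by (rule crooked_pair_cut[where m = "2*r", OF cont])
        (use that False r2[of c] r3[of d] r f2r c2[of c "2*r"] in \<open>auto simp: closed_segment_eq_real_ivl\<close>)
  qed
  have c13: "crooked_pair 3 f c d" if c: "c \<in> {0..r}" and d: "d \<in> {2*r..3*r}" for c d
  proof -
    have ab: "0 \<le> f c" "f c \<le> k" "1 \<le> f d" "f d \<le> k + 1"
      using r1[of c] r3[of d] c d by auto
    show ?thesis
    proof (cases "f c \<le> f d")
      case True
      \<comment> \<open>Heights outside \<open>{1..k}\<close> are missed by the descent; clipping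
        them to this range costs at most 1, which is less than 3.\<close>
      define y z where "y = min (f d) k" and "z = max (f c) 1"
      have yz: "1 \<le> z" "z \<le> y" "y \<le> k" using ab True k by (auto simp: y_def z_def)
      obtain p where p: "r \<le> p" "p \<le> 2 * r" "f p = y"
        using IVT2'[of f "2*r" y r] yz r cont fr f2r by auto
      obtain q where q: "p \<le> q" "q \<le> 2 * r" "f q = z"
        using IVT2'[of f "2*r" z p] yz p cont f2r by auto
      show ?thesis
        by (rule crkI_ordered[of c p q d])
          (use ab c d p q in \<open>auto simp: y_def z_def min_def max_def split: if_splits\<close>)
    next
      \<comment> \<open>Here both values are taken exactly on the descent and in the same order, so
        the crookedness of the descent applies.\<close>
      case False
      obtain p where p: "r \<le> p" "p \<le> 2 * r" "f p = f c"
        using IVT2'[of f "2*r" "f c" r] ab False r cont fr f2r by auto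
      obtain q where q: "p \<le> q" "q \<le> 2 * r" "f q = f d"
        using IVT2'[of f "2*r" "f d" p] ab False p cont f2r by auto
      have "crooked_pair (3 + 0) f c d"
        by (rule crooked_pair_extend[where ?c1.0 = p and ?d1.0 = q])
          (use c d p q c2[of p q] in \<open>auto simp: closed_segment_eq_real_ivl\<close>)
      then show ?thesis by simp
    qed
  qed
  have cc: "crooked_pair 3 f c d" if "c \<in> {0..3*r}" "d \<in> {0..3*r}" "c \<le> d" for c d
  proof -
    consider "d \<le> r" | "c \<le> r" "r \<le> d" "d \<le> 2*r" | "c \<le> r" "2*r \<le> d" | "r \<le> c" "d \<le> 2*r"
      | "r \<le> c" "c \<le> 2*r" "2*r \<le> d" | "2*r \<le> c" by linarith
    then show ?thesis by cases (use that c1 c12 c13 c2 c23 c3 in auto)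
  qed
  have "crooked_path (k + 1) (3 * r) f"
    unfolding crooked_path_def
  proof (intro conjI ballI allI impI)
    show "continuous_on UNIV f" by (rule cont)
    show "f u = 0" if "u \<le> 0" for u using that r by (simp add: f1 g0)
    show "f u = k + 1" if "u \<ge> 3 * r" for u using that r by (simp add: f3 g1)
    show "f u \<in> {0..k+1}" for u
      using r1[of u] r2[of u] r3[of u] k by (cases "u \<le> r"; cases "u \<le> 2*r") auto
    show "crooked_pair 3 f c d" if "c \<in> {0..3*r}" "d \<in> {0..3*r}" for c d
      using cc[OF that] cc[OF that(2,1)] crooked_pair_sym by (cases "c \<le> d") auto
    show "nonflat (3 * r) f"
    proof (rule nonflatI)
      fix u v :: real assume uv: "0 \<le> u" "u < v" "v \<le> 3 * r"
      consider "u < r" | "r \<le> u" "u < 2 * r" | "2 * r \<le> u" by linarith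
      then show "\<exists>s\<in>{u..v}. \<exists>t\<in>{u..v}. f s \<noteq> f t"
      proof cases
        case 1
        obtain s t where "s \<in> {u..min v r}" "t \<in> {u..min v r}" "g s \<noteq> g t"
          using nonflat_obtain_less[OF gn, of u "min v r"] uv 1 by auto
        then show ?thesis by (intro bexI[of _ s] bexI[of _ t]) (auto simp: f1)
      next
        case 2
        obtain s t where "s \<in> {u-r..min v (2*r)-r}" "t \<in> {u-r..min v (2*r)-r}" "g s \<noteq> g t"
          using nonflat_obtain_less[OF gn, of "u - r" "min v (2*r) - r"] uv 2 by auto
        then show ?thesis using 2 l by (intro bexI[of _ "s+r"] bexI[of _ "t+r"]) (auto simp: f2)
      next
        case 3
        obtain s t where "s \<in> {u-2*r..v-2*r}" "t \<in> {u-2*r..v-2*r}" "g s \<noteq> g t"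
          using nonflat_obtain_less[OF gn, of "u-2*r" "v-2*r"] uv 3 by auto
        then show ?thesis using 3 by (intro bexI[of _ "s+2*r"] bexI[of _ "t+2*r"]) (auto simp: f3)
      qed
    qed
  qed (use r in auto)
  then show ?thesis by (intro exI)
qed

lemma crooked_path_exists: "\<exists>r g. crooked_path (real (n + 2)) r g"
proof (induction n)
  case 0
  \<comment> \<open>At height 2 any two values are closer than 3.\<close>
  define g :: "real \<Rightarrow> real" where "g u = max 0 (min 2 u)" for u
  have "crooked_path 2 2 g"
    unfolding crooked_path_def
  proof (intro conjI ballI allI impI)
    show "continuous_on UNIV g" unfolding g_def by (intro continuous_intros)
    show "crooked_pair 3 g c d" for c d by (rule crooked_pair_near) (auto simp: g_def)
    show "nonflat 2 g"
    proof (rule nonflatI)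
      fix u v :: real assume "0 \<le> u" "u < v" "v \<le> 2"
      then show "\<exists>s\<in>{u..v}. \<exists>t\<in>{u..v}. g s \<noteq> g t"
        by (intro bexI[of _ u] bexI[of _ v]) (auto simp: g_def)
    qed
  qed (auto simp: g_def)
  then show ?case by auto
next
  case (Suc n)
  then obtain r g where "crooked_path (real (n + 2)) r g" by blast
  from crooked_path_Suc[OF _ this] show ?case by (simp add: add.commute)
qed

definition profile :: "(real \<Rightarrow> real) \<Rightarrow> bool" where
  "profile \<kappa> \<longleftrightarrow> continuous_on {0..1} \<kappa> \<and> \<kappa> 0 = 0 \<and> \<kappa> 1 = 1 \<and> \<kappa> ` {0..1} \<subseteq> {0..1}"

lemma crooked_profile_exists:
  assumes "0 < e"
  obtains \<kappa> where "profile \<kappa>" "nonflat 1 \<kappa>" "\<And>c d. c \<in> {0..1} \<Longrightarrow> d \<in> {0..1} \<Longrightarrow> crooked_pair e \<kappa> c d"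
proof -
  obtain n where n: "3 / e < real n" using reals_Archimedean2 by blast
  define k where "k = real (n + 2)"
  have k: "0 < k" "3 / k < e" using n assms by (auto simp: k_def field_simps)
  obtain r g where g: "crooked_path k r g" using crooked_path_exists unfolding k_def by blast
  have r: "0 < r" and gc: "continuous_on UNIV g" and g0: "g 0 = 0" and g1: "g r = k"
    and gr: "\<And>u. g u \<in> {0..k}" and gn: "nonflat r g"
    and gk: "\<And>c d. c \<in> {0..r} \<Longrightarrow> d \<in> {0..r} \<Longrightarrow> crooked_pair 3 g c d"
    using g unfolding crooked_path_def by blast+
  define f where "f u = g (r * u) / k" for u
  have "profile f"
    unfolding profile_def f_def
  proof (intro conjI image_subsetI)
    show "continuous_on {0..1} (\<lambda>u. g (r * u) / k)"
      using k by (intro continuous_intros continuous_on_compose2[OF gc]) auto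
    show "g (r * u) / k \<in> {0..1}" for u using gr[of "r * u"] k by (auto simp: field_simps)
  qed (use g0 g1 k in auto)
  moreover have "nonflat 1 f"
  proof (rule nonflatI)
    fix u v :: real assume uv: "0 \<le> u" "u < v" "v \<le> 1"
    obtain s t where st: "s \<in> {r * u..r * v}" "t \<in> {r * u..r * v}" "g s \<noteq> g t"
      using nonflat_obtain_less[OF gn, of "r * u" "r * v"] uv r by (auto simp: mult_left_le)
    then show "\<exists>s\<in>{u..v}. \<exists>t\<in>{u..v}. f s \<noteq> f t"
      using r k by (intro bexI[of _ "s/r"] bexI[of _ "t/r"]) (auto simp: f_def field_simps)
  qed
  moreover have "crooked_pair e f c d" if cd: "c \<in> {0..1}" "d \<in> {0..1}" for c d
  proof -
    have "crooked_pair 3 g (r * c) (r * d)" using gk cd r by (auto simp: mult_left_le)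
    then have 1: "crooked_pair 3 (g \<circ> (\<lambda>u. r * u)) c d" by (intro crooked_pair_comp_right continuous_intros)
    have 2: "\<bar>f x - f t\<bar> < e" if "\<bar>g (r * x) - g (r * t)\<bar> < 3" for x t
    proof -
      have "\<bar>f x - f t\<bar> = \<bar>g (r * x) - g (r * t)\<bar> / k"
        using k by (simp add: f_def diff_divide_distrib[symmetric])
      also have "\<dots> < 3 / k" using that k by (simp add: divide_strict_right_mono)
      finally show ?thesis using k by simp
    qed
    show ?thesis by (rule crooked_pair_comp_left[OF 1]) (auto intro: 2)
  qed
  ultimately show ?thesis by (rule that)
qed

section \<open>Crooked compositions of degree one maps\<close>

text \<open>The lift to the line of the circle map given by \<open>\<kappa>\<close>, with the unit
  blocks of the line starting at \<open>x\<close> and its integer translates.\<close>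

definition block_map :: "real \<Rightarrow> (real \<Rightarrow> real) \<Rightarrow> real \<Rightarrow> real" where
  "block_map x \<kappa> t = t + (\<kappa> (frac (t - x)) - frac (t - x))"

text \<open>The formula also covers the right end of the block, because a profile fixes 1.\<close>

lemma block_map_eq:
  assumes "profile \<kappa>" "x + of_int k \<le> t" "t \<le> x + of_int k + 1"
  shows "block_map x \<kappa> t = x + of_int k + \<kappa> (t - x - of_int k)"
proof (cases "t = x + of_int k + 1")
  case True
  have "frac (t - x) = 0" unfolding True by (simp add: frac_eq_0_iff)
  then show ?thesis using assms True by (auto simp: block_map_def profile_def)
next
  case False
  have "frac (t - x) = t - x - of_int k"
    using assms False by (subst frac_unique_iff) auto
  then show ?thesis by (simp add: block_map_def)
qed

lemma block_map_add_int: "block_map x \<kappa> (t + of_int n) = block_map x \<kappa> t + of_int n"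
proof -
  have "frac (t + of_int n - x) = frac (t - x)" by (simp add: frac_def algebra_simps floor_diff_of_int)
      (metis add_diff_eq floor_add_int add.commute floor_diff_of_int of_int_add diff_add_eq)
  then show ?thesis by (simp add: block_map_def)
qed

lemma block_map_shift: "block_map (x + of_int n) \<kappa> t = block_map x \<kappa> t"
proof -
  have "block_map x \<kappa> (t + of_int (- n)) = block_map x \<kappa> t - of_int n" by (subst block_map_add_int) simp
  moreover have "block_map (x + of_int n) \<kappa> t = block_map x \<kappa> (t + of_int (- n)) + of_int n"
    by (simp add: block_map_def algebra_simps)
  ultimately show ?thesis by simp
qed

lemma block_map_mem:
  assumes "profile \<kappa>" "x + of_int k \<le> t" "t \<le> x + of_int k + 1"
  shows "x + of_int k \<le> block_map x \<kappa> t" "block_map x \<kappa> t \<le> x + of_int k + 1"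
proof -
  have "t - x - of_int k \<in> {0..1}" using assms by auto
  then have "\<kappa> (t - x - of_int k) \<in> {0..1}" using assms(1) unfolding profile_def by blast
  then show "x + of_int k \<le> block_map x \<kappa> t" "block_map x \<kappa> t \<le> x + of_int k + 1"
    using assms by (auto simp: block_map_eq)
qed

lemma block_ex:
  fixes x t :: real
  obtains k :: int where "x + of_int k \<le> t" "t < x + of_int k + 1"
  using that[of "\<lfloor>t - x\<rfloor>"] by linarith

lemma block_map_near: "profile \<kappa> \<Longrightarrow> \<bar>block_map x \<kappa> t - t\<bar> \<le> 1"
  using block_ex[of x t] block_map_mem[of \<kappa> x _ t] by (smt (verit))

lemma block_map_cut: "profile \<kappa> \<Longrightarrow> block_map x \<kappa> (x + of_int k) = x + of_int k"
  by (subst block_map_eq) (auto simp: profile_def)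

lemma continuous_block_map_block:
  assumes "profile \<kappa>" shows "continuous_on {x + of_int k..x + of_int k + 1} (block_map x \<kappa>)"
proof -
  have "continuous_on {x + of_int k..x + of_int k + 1} (\<lambda>t. x + of_int k + \<kappa> (t - x - of_int k))"
  proof (rule continuous_on_add[OF continuous_on_const], rule continuous_on_compose2[where t = "{0..1}" and f = "\<lambda>t. t - x - of_int k"])
    show "continuous_on {0..1} \<kappa>" using assms by (simp add: profile_def)
  qed (auto intro!: continuous_intros)
  then show ?thesis by (rule continuous_on_eq) (use assms in \<open>auto simp: block_map_eq\<close>)
qed

lemma continuous_block_map:
  assumes "profile \<kappa>" shows "continuous_on UNIV (block_map x \<kappa>)"
proof (rule continuous_at_imp_continuous_on, rule ballI)
  fix t :: real
  obtain k :: int where k: "x + of_int k \<le> t" "t < x + of_int k + 1" by (rule block_ex)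
  \<comment> \<open>A grid point is the left end of its block, so the preceding block is added to
    obtain a neighbourhood of \<open>t\<close>.\<close>
  have "continuous_on ({x + of_int (k - 1)..x + of_int (k - 1) + 1} \<union> {x + of_int k..x + of_int k + 1}) (block_map x \<kappa>)"
    by (intro continuous_on_closed_Un continuous_block_map_block assms) auto
  moreover have "{x + of_int (k - 1)<..<x + of_int k + 1} \<subseteq> 
      {x + of_int (k - 1)..x + of_int (k - 1) + 1} \<union> {x + of_int k..x + of_int k + 1}" by auto
  ultimately have "continuous_on {x + of_int (k - 1)<..<x + of_int k + 1} (block_map x \<kappa>)"
    by (rule continuous_on_subset)
  then show "isCont (block_map x \<kappa>) t"
    by (rule continuous_on_interior) (use k in \<open>auto simp: interior_open\<close>)
qed

lemma crooked_pair_block_map: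
  assumes "profile \<kappa>" "\<And>c d. c \<in> {0..1} \<Longrightarrow> d \<in> {0..1} \<Longrightarrow> crooked_pair e \<kappa> c d"
    and "c \<in> {x + of_int k..x + of_int k + 1}" "d \<in> {x + of_int k..x + of_int k + 1}"
  shows "crooked_pair e (block_map x \<kappa>) c d"
proof (rule crooked_pair_affine[where g = \<kappa> and s = "x + of_int k" and a = "x + of_int k" and l = 1])
  show "block_map x \<kappa> t = x + of_int k + 1 * \<kappa> (t - (x + of_int k))" if "t \<in> closed_segment c d" for t
  proof -
    have "x + of_int k \<le> t" "t \<le> x + of_int k + 1"
      using that assms(3,4) by (auto simp: closed_segment_eq_real_ivl split: if_splits)
    then show ?thesis by (simp add: block_map_eq[OF assms(1)] diff_diff_eq)
  qed
  show "crooked_pair e \<kappa> (c - (x + of_int k)) (d - (x + of_int k))"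
    using assms(3,4) by (intro assms(2)) auto
qed simp

section \<open>Compositions of lifts of degree one\<close>

definition degree_one :: "(real \<Rightarrow> real) \<Rightarrow> bool" where
  "degree_one W \<longleftrightarrow> continuous_on UNIV W \<and> (\<forall>t. \<forall>n::int. W (t + of_int n) = W t + of_int n)"

lemma degree_one_cont: "degree_one W \<Longrightarrow> continuous_on A W"
  unfolding degree_one_def using continuous_on_subset by blast

lemma degree_one_add: "degree_one W \<Longrightarrow> W (t + of_int n) = W t + of_int n"
  unfolding degree_one_def by blast

lemma degree_one_id: "degree_one id" by (simp add: degree_one_def)

lemma degree_one_block_map: "profile \<kappa> \<Longrightarrow> degree_one (block_map x \<kappa>)"
  by (simp add: degree_one_def continuous_block_map block_map_add_int)

lemma degree_one_comp: "degree_one V \<Longrightarrow> degree_one W \<Longrightarrow> degree_one (V \<circ> W)"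
  unfolding degree_one_def by (intro conjI continuous_on_compose) (auto intro: continuous_on_subset)

lemma degree_one_uniform:
  assumes W: "degree_one W" and e: "0 < e"
  obtains g where "0 < g" "\<And>s t. \<bar>s - t\<bar> < g \<Longrightarrow> \<bar>W s - W t\<bar> < e"
proof -
  \<comment> \<open>By periodicity one compact interval suffices: \<open>s\<close> can be moved into
    \<open>{0..1}\<close>, and then \<open>t\<close> lies within 1 of it.\<close>
  have "uniformly_continuous_on {-1..2} W"
    by (intro compact_uniformly_continuous degree_one_cont W) simp
  then obtain g where g: "0 < g" "\<And>s t. s \<in> {-1..2} \<Longrightarrow> t \<in> {-1..2} \<Longrightarrow> dist s t < g \<Longrightarrow> dist (W s) (W t) < e"
    unfolding uniformly_continuous_on_def using e by metis
  show ?thesis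
  proof (rule that[of "min g 1"])
    fix s t :: real assume st: "\<bar>s - t\<bar> < min g 1"
    obtain k :: int where k: "0 + of_int k \<le> s" "s < 0 + of_int k + 1" by (rule block_ex)
    have "dist (W (s + of_int (- k))) (W (t + of_int (- k))) < e"
      by (rule g(2)) (use k st in \<open>auto simp: dist_real_def\<close>)
    then show "\<bar>W s - W t\<bar> < e" by (simp only: degree_one_add[OF W] dist_real_def add_diff_add diff_self add_0_right)
  qed (use g in auto)
qed

definition good_profile :: "(real \<Rightarrow> real) \<Rightarrow> bool" where
  "good_profile \<kappa> \<longleftrightarrow> profile \<kappa> \<and> nonflat 1 \<kappa>"

text \<open>The block with the highest index acts first, as it is the first one met on the way
  down.\<close>

primrec block_product :: "(nat \<Rightarrow> real \<times> (real \<Rightarrow> real)) \<Rightarrow> nat \<Rightarrow> nat \<Rightarrow> real \<Rightarrow> real" where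
  "block_product B a 0 = id"
| "block_product B a (Suc n) = block_product B a n \<circ> block_map (fst (B (a + n))) (snd (B (a + n)))"

text \<open>Shifting a block by an integer leaves \<open>block_map\<close> unchanged, so only
  positions modulo 1 matter; this allows a finite composition to be moved arbitrarily far
  up.\<close>

lemma block_product_cong:
  assumes "\<And>j. j < n \<Longrightarrow> snd (B (a + j)) = snd (B' (a' + j))"
    and "\<And>j. j < n \<Longrightarrow> \<exists>i::int. fst (B (a + j)) = fst (B' (a' + j)) + of_int i"
  shows "block_product B a n = block_product B' a' n"
  using assms
proof (induction n)
  case (Suc n)
  obtain i :: int where "fst (B (a + n)) = fst (B' (a' + n)) + of_int i" using Suc.prems(2)[of n] by auto
  then have "block_map (fst (B (a + n))) (snd (B (a + n))) = block_map (fst (B' (a' + n))) (snd (B' (a' + n)))"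
    using Suc.prems(1)[of n] by (intro ext) (simp add: block_map_shift)
  then show ?case using Suc by simp
qed simp

definition block_comp :: "(real \<Rightarrow> real) \<Rightarrow> bool" where
  "block_comp W \<longleftrightarrow> (\<exists>n B. (\<forall>j<n. good_profile (snd (B j))) \<and> W = block_product B 0 n)"

lemma block_comp_id: "block_comp id"
  unfolding block_comp_def by (intro exI[of _ 0]) auto

lemma block_comp_block_map:
  assumes "block_comp W" "good_profile \<kappa>" shows "block_comp (W \<circ> block_map x \<kappa>)"
proof -
  obtain n B where *: "\<forall>j<n. good_profile (snd (B j))" "W = block_product B 0 n"
    using assms unfolding block_comp_def by blast
  have "block_product B 0 n = block_product (B(n := (x, \<kappa>))) 0 n" by (rule block_product_cong) (auto intro: exI[of _ 0])
  then have "W \<circ> block_map x \<kappa> = block_product (B(n := (x, \<kappa>))) 0 (Suc n)" using * by simp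
  moreover have "\<forall>j<Suc n. good_profile (snd ((B(n := (x, \<kappa>))) j))" using * assms(2) by (auto simp: less_Suc_eq)
  ultimately show ?thesis unfolding block_comp_def by blast
qed

lemma degree_one_block_product: "(\<And>j. j < n \<Longrightarrow> profile (snd (B (a + j)))) \<Longrightarrow> degree_one (block_product B a n)"
  by (induction n) (auto simp: degree_one_id intro!: degree_one_comp degree_one_block_map)

lemma block_comp_degree_one: "block_comp W \<Longrightarrow> degree_one W"
  unfolding block_comp_def by (auto intro!: degree_one_block_product simp: good_profile_def)

definition block_crooked :: "real \<Rightarrow> real \<Rightarrow> (real \<Rightarrow> real) \<Rightarrow> bool" where
  "block_crooked e x V \<longleftrightarrow> (\<forall>k::int. \<forall>c\<in>{x + of_int k..x + of_int k + 1}.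
     \<forall>d\<in>{x + of_int k..x + of_int k + 1}. crooked_pair e V c d)"

text \<open>A profile that is crooked at the scale given by the uniform continuity of
  \<open>W\<close> becomes crooked at scale \<open>e\<close> after \<open>W\<close>.\<close>

lemma crooked_block_exists:
  assumes W: "block_comp W" and e: "0 < e"
  obtains \<kappa> where "profile \<kappa>" "block_comp (W \<circ> block_map x \<kappa>)"
    "block_crooked e x (W \<circ> block_map x \<kappa>)"
proof -
  obtain g where g: "0 < g" "\<And>s t. \<bar>s - t\<bar> < g \<Longrightarrow> \<bar>W s - W t\<bar> < e"
    using degree_one_uniform[OF block_comp_degree_one[OF W] e] by blast
  obtain \<kappa> where \<kappa>: "profile \<kappa>" "nonflat 1 \<kappa>" "\<And>c d. c \<in> {0..1} \<Longrightarrow> d \<in> {0..1} \<Longrightarrow> crooked_pair g \<kappa> c d"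
    using crooked_profile_exists[OF g(1)] by blast
  show ?thesis
  proof (rule that[of \<kappa>])
    show "block_crooked e x (W \<circ> block_map x \<kappa>)"
      unfolding block_crooked_def
    proof (intro allI ballI)
      fix c d and k :: int
      assume cd: "c \<in> {x + of_int k..x + of_int k + 1}" "d \<in> {x + of_int k..x + of_int k + 1}"
      have "crooked_pair g (block_map x \<kappa>) c d" by (rule crooked_pair_block_map[OF \<kappa>(1) \<kappa>(3) cd]) auto
      then show "crooked_pair e (W \<circ> block_map x \<kappa>) c d" by (rule crooked_pair_comp_left) (auto intro: g)
    qed
  qed (use \<kappa> W in \<open>auto simp: good_profile_def intro: block_comp_block_map\<close>)
qed

text \<open>Crookedness between \<open>p\<close> and \<open>z\<close> makes the new composition come
  close to \<open>W q\<close> at some \<open>c'\<close> and later close to \<open>W p\<close> at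
  some \<open>d'\<close>. From \<open>d'\<close> to \<open>c' + 1\<close>, one turn after
  \<open>c'\<close>, the value rises by \<open>W q - W p + 1\<close> up to an error 1/2, so each
  round gains at least 1/2.\<close>

lemma wide_block_comp:
  "\<exists>W p q. block_comp W \<and> p \<le> q \<and> q \<le> p + 1 \<and> real n / 2 \<le> W q - W p"
proof (induction n)
  case 0
  show ?case by (intro exI[of _ id] exI[of _ 0]) (use block_comp_id in \<open>simp_all add: id_def\<close>)
next
  case (Suc n)
  then obtain W p q where W: "block_comp W" and pq: "p \<le> q" "q \<le> p + 1" and w: "real n / 2 \<le> W q - W p" by blast
  obtain \<kappa> where \<kappa>: "profile \<kappa>" "block_comp (W \<circ> block_map p \<kappa>)"
    "block_crooked (1/4) p (W \<circ> block_map p \<kappa>)"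
    using crooked_block_exists[OF W, of "1/4" p] by auto
  let ?V = "W \<circ> block_map p \<kappa>"
  have pp: "block_map p \<kappa> p = p" "block_map p \<kappa> (p + 1) = p + 1"
    using block_map_cut[OF \<kappa>(1), of p 0] block_map_cut[OF \<kappa>(1), of p 1] by auto
  obtain z where z: "p \<le> z" "z \<le> p + 1" "block_map p \<kappa> z = q"
    using IVT'[of "block_map p \<kappa>" p q "p + 1"] pp pq continuous_on_subset[OF continuous_block_map[OF \<kappa>(1)]] by auto
  have "crooked_pair (1/4) ?V p z" using \<kappa>(3)[unfolded block_crooked_def, rule_format, where k = 0] z by auto
  from crooked_pair_ordered[OF this z(1)] obtain c' d' where *: "p \<le> c'" "c' \<le> d'" "d' \<le> z"
    "\<bar>?V z - ?V c'\<bar> < 1/4" "\<bar>?V p - ?V d'\<bar> < 1/4" by blast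
  have "?V (c' + 1) = ?V c' + 1" using degree_one_add[OF block_comp_degree_one[OF \<kappa>(2)], of c' 1] by simp
  moreover have "?V z = W q" "?V p = W p" using z pp by simp_all
  moreover have "real (Suc n) / 2 = real n / 2 + 1 / 2" by (simp add: field_simps)
  ultimately have "real (Suc n) / 2 \<le> ?V (c' + 1) - ?V d'" using *(4,5) w by linarith
  moreover have "d' \<le> c' + 1" "c' + 1 \<le> d' + 1" using * z by auto
  ultimately show ?case using \<kappa>(2) by blast
qed

text \<open>The interval from \<open>q\<close> to \<open>p + 1\<close> lies in
  \<open>{y..y + 1}\<close>, and on it \<open>V\<close> passes from \<open>V q\<close> to
  \<open>V p + 1\<close>.\<close>

lemma wide_cut:
  assumes V: "degree_one V" and pq: "p \<le> q" "q \<le> p + 1" and s: "V p \<le> s" "s \<le> V q"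
  obtains y where "p \<le> y" "y \<le> q" "V y = s" "{V p + 1..V q} \<subseteq> V ` {y..y + 1}"
proof -
  obtain y where y: "p \<le> y" "y \<le> q" "V y = s"
    using IVT'[of V p s q] pq s degree_one_cont[OF V] by auto
  have p1: "V (p + 1) = V p + 1" using degree_one_add[OF V, of p 1] by simp
  have "{V p + 1..V q} \<subseteq> V ` {y..y + 1}"
  proof
    fix z assume "z \<in> {V p + 1..V q}"
    then obtain w where "q \<le> w" "w \<le> p + 1" "V w = z"
      using IVT2'[of V "p + 1" z q] p1 pq degree_one_cont[OF V] by auto
    then show "z \<in> V ` {y..y + 1}" using y by (intro image_eqI[of _ _ w]) auto
  qed
  with y show ?thesis by (rule that)
qed

text \<open>
  If the values of a pair do not straddle the value at a cut between them, then crookedness of the pair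
  is inherited from a single block.
\<close>

lemma crooked_pair_or_straddle:
  assumes V: "degree_one V" and bc: "block_crooked e x V"
    and rng: "{V x - M..V x + 1 + M} \<subseteq> V ` {x..x + 1}"
    and cd: "c \<le> d" "\<bar>V c - V d\<bar> \<le> M" and ncrk: "\<not> crooked_pair e V c d"
  obtains l :: int where "x + of_int l - 1 \<le> c" "c \<le> x + of_int l" "x + of_int l \<le> d" "d \<le> x + of_int l + 1"
     "min (V c) (V d) < V x + of_int l" "V x + of_int l < max (V c) (V d)"
proof -
  note blk = bc[unfolded block_crooked_def, rule_format]
  have cut: "V (x + of_int i) = V x + of_int i" for i by (rule degree_one_add[OF V])
  note cont = degree_one_cont[OF V]
  obtain k :: int where k: "x + of_int k \<le> c" "c < x + of_int k + 1" by (rule block_ex)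
  obtain l :: int where l': "x + of_int l \<le> d" "d < x + of_int l + 1" by (rule block_ex)
  then have l: "x + of_int l \<le> d" "d \<le> x + of_int l + 1" by auto
  have "k \<noteq> l" using ncrk blk[of c k d] k l by auto
  moreover have "of_int k < (of_int l :: real) + 1" using k l' cd(1) by linarith
  ultimately have kl: "k + 1 \<le> l" by linarith
  then have kl': "of_int k + 1 \<le> (of_int l :: real)" by linarith
  have M: "0 \<le> M" using cd(2) by linarith
  \<comment> \<open>A whole block between the two points whose image contains both values would
    provide witnesses: exact ones if the values occur there in reverse order, otherwise those from
    the crookedness within that block.\<close>
  have mid: False if i: "k + 1 \<le> i" "i + 1 \<le> l"
    and a: "V c \<in> {V x + of_int i - M..V x + of_int i + 1 + M}"
    and b: "V d \<in> {V x + of_int i - M..V x + of_int i + 1 + M}" for i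
  proof -
    have i': "of_int k + 1 \<le> (of_int i :: real)" "of_int i + 1 \<le> (of_int l :: real)" using i by linarith+
    have img: "\<exists>w\<in>{x + of_int i..x + of_int i + 1}. V w = z" 
      if "z \<in> {V x + of_int i - M..V x + of_int i + 1 + M}" for z
    proof -
      have "z - of_int i \<in> V ` {x..x + 1}" using that rng by force
      then obtain w where "w \<in> {x..x + 1}" "V w = z - of_int i" by auto
      then show ?thesis using degree_one_add[OF V, of w i] by (intro bexI[of _ "w + of_int i"]) auto
    qed
    obtain u v where u: "u \<in> {x + of_int i..x + of_int i + 1}" "V u = V c"
      and v: "v \<in> {x + of_int i..x + of_int i + 1}" "V v = V d"
      using img[OF a] img[OF b] by blast
    have cud: "c \<le> u" "u \<le> d" "c \<le> v" "v \<le> d" using u v i' k l by auto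
    have "crooked_pair e V c d"
    proof (cases "u \<le> v")
      case True
      have "crooked_pair (e + 0) V c d"
        by (rule crooked_pair_extend[of u c d v]) (use True cud u v blk[OF u(1) v(1)] cd in \<open>auto simp: closed_segment_eq_real_ivl\<close>)
      then show ?thesis by simp
    next
      case False
      have "crooked_pair (e + 0) V u v" using blk[OF u(1) v(1)] by simp
      then have pos: "0 < e" unfolding crooked_pair_def by force
      then show ?thesis using cud u v False by (intro crkI_ordered[of c v u d]) auto
    qed
    then show False using ncrk by simp
  qed
  \<comment> \<open>Otherwise \<open>crooked_pair_cut\<close> would apply to \<open>c\<close> and
    the next grid point, which lie in one block.\<close>
  have left: "V d \<notin> closed_segment (V c) (V x + of_int k + 1)"
  proof
    assume *: "V d \<in> closed_segment (V c) (V x + of_int k + 1)"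
    have "crooked_pair e V c d"
    proof (rule crooked_pair_cut[OF cont])
      show "x + of_int k + 1 \<in> closed_segment c d"
        using k kl' l cd(1) by (auto simp: closed_segment_eq_real_ivl)
      show "crooked_pair e V c (x + of_int k + 1)" by (rule blk[of _ k]) (use k in auto)
      show "V d \<in> closed_segment (V c) (V (x + of_int k + 1))" using * cut[of "k + 1"] by (simp add: add.assoc)
    qed
    then show False using ncrk by simp
  qed
  have right: "V c \<notin> closed_segment (V d) (V x + of_int l)"
  proof
    assume *: "V c \<in> closed_segment (V d) (V x + of_int l)"
    have "crooked_pair e V c d"
    proof (rule crooked_pair_cut'[OF cont])
      show "x + of_int l \<in> closed_segment c d"
        using k kl' l cd(1) by (auto simp: closed_segment_eq_real_ivl)
      show "crooked_pair e V (x + of_int l) d" by (rule blk[of _ l]) (use l in auto)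
      show "V c \<in> closed_segment (V d) (V (x + of_int l))" using * cut[of l] by simp
    qed
    then show False using ncrk by simp
  qed
  \<comment> \<open>If there were a whole block in between, one could be chosen whose image contains
    both values, against \<open>mid\<close>; so the two points lie in adjacent blocks.\<close>
  have "l = k + 1"
  proof (rule ccontr)
    assume "l \<noteq> k + 1"
    then have kl2: "k + 2 \<le> l" "of_int k + 2 \<le> (of_int l :: real)" using kl by linarith+
    show False
    proof (cases "V c \<le> V d")
      case True
      then have b: "V x + of_int k + 1 < V d" "V c < V x + of_int l"
        using left right by (auto simp: closed_segment_eq_real_ivl split: if_splits)
      show False
      proof (cases "V c \<le> V x + of_int k + 1")
        case True
        show False by (rule mid[of "k + 1"]) (use kl2 True b cd(2) in auto)
      next
        case False
        obtain i :: int where i: "V x + of_int i \<le> V c" "V c < V x + of_int i + 1" by (rule block_ex)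
        have "k < i" "i < l" using i b False by linarith+
        show False by (rule mid[of i]) (use \<open>k < i\<close> \<open>i < l\<close> i cd(2) True M in auto)
      qed
    next
      case False
      then have b: "V d < V x + of_int k + 1" "V x + of_int l < V c"
        using left right by (auto simp: closed_segment_eq_real_ivl split: if_splits)
      show False by (rule mid[of "k + 1"]) (use kl2 b cd(2) in auto)
    qed
  qed
  moreover have "min (V c) (V d) < V x + of_int l \<and> V x + of_int l < max (V c) (V d)"
    using left right \<open>l = k + 1\<close> by (auto simp: closed_segment_eq_real_ivl split: if_splits)
  ultimately show ?thesis using that[of l] k l by auto
qed

text \<open>Two cuts are used whose values differ by \<open>M + 5\<close>. A pair failing for
  \<open>U\<close> straddles the value at a grid point of \<open>y\<close>; its image under the
  inner block map fails for \<open>V\<close> and straddles the value at a grid point of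
  \<open>x\<close>. The indices of these grid points differ by at most 4, so the two cut values
  differ by at least \<open>M + 1\<close>, whereas both lie between two values at distance at most
  \<open>M\<close>.\<close>

lemma crooked_block_comp:
  assumes M: "0 \<le> M" and e: "0 < e"
  obtains U where "block_comp U" "\<And>c d. \<bar>U c - U d\<bar> \<le> M \<Longrightarrow> crooked_pair e U c d"
proof -
  \<comment> \<open>The cuts will have heights \<open>M + 1\<close> and \<open>2 * M + 6\<close>
    above \<open>W p\<close>, and the image must reach \<open>M + 1\<close> above the second one;
    this needs the width \<open>3 * M + 7\<close>.\<close>
  obtain n where n: "2 * (3 * M + 7) < real n" using reals_Archimedean2 by blast
  obtain W p q where W: "block_comp W" and pq: "p \<le> q" "q \<le> p + 1" and "real n / 2 \<le> W q - W p"
    using wide_block_comp by blast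
  moreover have "3 * M + 7 < real n / 2" using n by simp
  ultimately have w: "3 * M + 7 \<le> W q - W p" by linarith
  obtain x where x: "p \<le> x" "x \<le> q" "W x = W p + 1 + M" "{W p + 1..W q} \<subseteq> W ` {x..x + 1}"
    using wide_cut[OF block_comp_degree_one[OF W] pq, of "W p + 1 + M"] w M by auto
  obtain \<kappa> where \<kappa>: "profile \<kappa>" "block_comp (W \<circ> block_map x \<kappa>)"
    "block_crooked e x (W \<circ> block_map x \<kappa>)"
    using crooked_block_exists[OF W e] by metis
  define V where "V = W \<circ> block_map x \<kappa>"
  note V = \<kappa>(2)[folded V_def] and Vc = \<kappa>(3)[folded V_def]
  have pc: "continuous_on A (block_map x \<kappa>)" for A using continuous_block_map[OF \<kappa>(1)] continuous_on_subset by blast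
  have cut: "block_map x \<kappa> (x - 1) = x - 1" "block_map x \<kappa> x = x" "block_map x \<kappa> (x + 1) = x + 1"
    using block_map_cut[OF \<kappa>(1), of x "-1"] block_map_cut[OF \<kappa>(1), of x 0] block_map_cut[OF \<kappa>(1), of x 1] by auto
  \<comment> \<open>Preimages of \<open>p\<close> and \<open>q\<close> on the two sides of
    \<open>x\<close> carry the width of \<open>W\<close> over to \<open>V\<close>, so that the
    second cut is found within distance 1 of the first.\<close>
  obtain p' where p': "x - 1 \<le> p'" "p' \<le> x" "block_map x \<kappa> p' = p"
    using IVT'[of "block_map x \<kappa>" "x - 1" p x] cut x pq pc by auto
  have "block_map x \<kappa> (p' + 1) = p + 1" using block_map_add_int[of x \<kappa> p' 1] p' by simp
  then obtain q' where q': "x \<le> q'" "q' \<le> p' + 1" "block_map x \<kappa> q' = q"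
    using IVT'[of "block_map x \<kappa>" x q "p' + 1"] cut x pq pc p' by auto
  have Vpq: "V p' = W p" "V q' = W q" "V x = W x" using p' q' cut by (auto simp: V_def)
  have Vx: "{V x - M..V x + 1 + M} \<subseteq> V ` {x..x + 1}"
  proof
    fix z assume "z \<in> {V x - M..V x + 1 + M}"
    then have "z \<in> {W p + 1..W q}" using x w M Vpq by auto
    then obtain u where u: "u \<in> {x..x + 1}" "W u = z" using x(4) by blast
    obtain v where "x \<le> v" "v \<le> x + 1" "block_map x \<kappa> v = u"
      using IVT'[of "block_map x \<kappa>" x u "x + 1"] cut pc u by auto
    then show "z \<in> V ` {x..x + 1}" using u by (intro image_eqI[of _ _ v]) (auto simp: V_def)
  qed
  obtain y where y: "p' \<le> y" "y \<le> q'" "V y = V x + M + 5" "{V p' + 1..V q'} \<subseteq> V ` {y..y + 1}"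
    using wide_cut[OF block_comp_degree_one[OF V], of p' q' "V x + M + 5"] p' q' w x M Vpq by auto
  obtain \<mu> where \<mu>: "profile \<mu>" "block_comp (V \<circ> block_map y \<mu>)"
    "block_crooked e y (V \<circ> block_map y \<mu>)"
    using crooked_block_exists[OF V e] by metis
  define U where "U = V \<circ> block_map y \<mu>"
  note U = \<mu>(2)[folded U_def] and Uc = \<mu>(3)[folded U_def]
  have mc: "continuous_on A (block_map y \<mu>)" for A using continuous_block_map[OF \<mu>(1)] continuous_on_subset by blast
  have cut': "block_map y \<mu> y = y" "block_map y \<mu> (y + 1) = y + 1"
    using block_map_cut[OF \<mu>(1), of y 0] block_map_cut[OF \<mu>(1), of y 1] by auto
  have Uy: "U y = V y" using cut' by (simp add: U_def)
  have Uy': "{U y - M..U y + 1 + M} \<subseteq> U ` {y..y + 1}"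
  proof
    fix z assume "z \<in> {U y - M..U y + 1 + M}"
    then have "z \<in> {V p' + 1..V q'}" using x y w M Vpq Uy by auto
    then obtain u where u: "u \<in> {y..y + 1}" "V u = z" using y(4) by blast
    obtain v where "y \<le> v" "v \<le> y + 1" "block_map y \<mu> v = u"
      using IVT'[of "block_map y \<mu>" y u "y + 1"] cut' mc u by auto
    then show "z \<in> U ` {y..y + 1}" using u by (intro image_eqI[of _ _ v]) (auto simp: U_def)
  qed
  have le: "crooked_pair e U c d" if cd: "c \<le> d" "\<bar>U c - U d\<bar> \<le> M" for c d
  proof (rule ccontr)
    assume ncrk: "\<not> crooked_pair e U c d"
    obtain l :: int where l: "y + of_int l - 1 \<le> c" "c \<le> y + of_int l"
       "min (U c) (U d) < U y + of_int l" "U y + of_int l < max (U c) (U d)"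
      using crooked_pair_or_straddle[OF block_comp_degree_one[OF U] Uc Uy' cd ncrk] by blast
    define u v where "u = block_map y \<mu> c" and "v = block_map y \<mu> d"
    have uv: "V u = U c" "V v = U d" by (auto simp: u_def v_def U_def)
    have nu: "\<not> crooked_pair e V u v"
      using ncrk crooked_pair_comp_right[of c d "block_map y \<mu>" e V] mc unfolding U_def u_def v_def by blast
    obtain i :: int where i: "\<bar>x + of_int i - u\<bar> \<le> 1"
       "min (U c) (U d) < V x + of_int i" "V x + of_int i < max (U c) (U d)"
    proof (cases "u \<le> v")
      case True
      show ?thesis
        using crooked_pair_or_straddle[OF block_comp_degree_one[OF V] Vc Vx True _ nu] uv cd that
        by (smt (verit, best))
    next
      case False
      then have vu: "v \<le> u" by simp
      have "\<not> crooked_pair e V v u" using nu crooked_pair_sym by blast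
      from crooked_pair_or_straddle[OF block_comp_degree_one[OF V] Vc Vx vu _ this] show ?thesis
        using uv cd that by (smt (verit, best))
    qed
    have "\<bar>u - c\<bar> \<le> 1" unfolding u_def by (rule block_map_near[OF \<mu>(1)])
    moreover have "\<bar>x - y\<bar> \<le> 1" using y p' q' by auto
    ultimately have "\<bar>of_int i - (of_int l :: real)\<bar> \<le> 4" using i l by linarith
    moreover have "\<bar>V x + of_int i - (U y + of_int l)\<bar> \<le> M" using i l cd(2) by linarith
    ultimately show False using Uy y(3) by linarith
  qed
  show ?thesis
  proof (rule that[OF U])
    fix c d assume "\<bar>U c - U d\<bar> \<le> M"
    then show "crooked_pair e U c d" using le[of c d] le[of d c] crooked_pair_sym[of e U d c] by (cases "c \<le> d") auto
  qed
qed

section \<open>Perturbed translations of the line\<close>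

definition bump :: "real \<Rightarrow> (real \<Rightarrow> real) \<Rightarrow> real \<Rightarrow> real" where
  "bump x \<kappa> t = \<kappa> (max 0 (min 1 (t - x))) - max 0 (min 1 (t - x))"

lemma bump_outside: "profile \<kappa> \<Longrightarrow> t \<le> x \<or> x + 1 \<le> t \<Longrightarrow> bump x \<kappa> t = 0"
  by (auto simp: bump_def profile_def)

lemma continuous_bump:
  assumes "profile \<kappa>" shows "continuous_on A (bump x \<kappa>)"
proof -
  have "continuous_on {0..1} \<kappa>" using assms by (simp add: profile_def)
  then have "continuous_on A (\<lambda>t. \<kappa> (max 0 (min 1 (t - x))))"
    by (rule continuous_on_compose2) (auto intro!: continuous_intros)
  then show ?thesis unfolding bump_def by (intro continuous_intros)
qed

text \<open>This map will semiconjugate the line map without the block at \<open>x\<close> to the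
  one with it.\<close>

definition half_block :: "real \<Rightarrow> (real \<Rightarrow> real) \<Rightarrow> real \<Rightarrow> real" where
  "half_block x \<kappa> t = (if t \<le> x then block_map x \<kappa> t else t)"

primrec half_product :: "(nat \<Rightarrow> real \<times> (real \<Rightarrow> real)) \<Rightarrow> nat \<Rightarrow> nat \<Rightarrow> real \<Rightarrow> real" where
  "half_product B a 0 = id"
| "half_product B a (Suc n) = half_product B a n \<circ> half_block (fst (B (a + n))) (snd (B (a + n)))"

lemma half_product_cong: "(\<And>j. j < n \<Longrightarrow> B (a + j) = B' (a + j)) \<Longrightarrow> half_product B a n = half_product B' a n"
  by (induction n) simp_all

lemma continuous_half_block:
  assumes "profile \<kappa>" shows "continuous_on A (half_block x \<kappa>)"
proof -
  have "block_map x \<kappa> x = x" using block_map_cut[OF assms, of x 0] by simp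
  then have "continuous_on UNIV (\<lambda>t. if t \<le> x then block_map x \<kappa> t else t)"
    by (intro continuous_on_cases_1)
      (use continuous_on_subset[OF continuous_block_map[OF assms]] in \<open>auto intro: continuous_on_id\<close>)
  then show ?thesis unfolding half_block_def[abs_def] by (rule continuous_on_subset) simp
qed

lemma continuous_half_product:
  "(\<And>j. j < n \<Longrightarrow> profile (snd (B (a + j)))) \<Longrightarrow> continuous_on A (half_product B a n)"
proof (induction n arbitrary: A)
  case (Suc n)
  show ?case unfolding half_product.simps
    by (intro continuous_on_compose continuous_half_block Suc) simp_all
qed (simp add: id_def)

text \<open>
  The blocks \<open>p, \<dots>, p + n - 1\<close> are crooked at a scale adapted to the earlier blocks, and so
  far away that all the points relevant at this stage lie below them when they have passed them.
\<close>

definition crooked_stage :: "nat \<Rightarrow> nat \<Rightarrow> nat \<Rightarrow> (nat \<Rightarrow> real \<times> (real \<Rightarrow> real)) \<Rightarrow> bool" where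
  "crooked_stage S p n B \<longleftrightarrow> (\<exists>e\<le>1.
      (\<forall>c d. \<bar>block_product B p n c - block_product B p n d\<bar> \<le> 2 * (real S + real p) \<longrightarrow> crooked_pair e (block_product B p n) c d) \<and>
      (\<forall>x y. \<bar>x\<bar> \<le> real S + real p \<longrightarrow> \<bar>x - y\<bar> < e \<longrightarrow> \<bar>half_product B 0 p x - half_product B 0 p y\<bar> < 1 / (real S + 1)) \<and>
      real S + real p + 2 * real n + 1 \<le> fst (B p))"

text \<open>A point leaving block \<open>j\<close> lands in \<open>{X j - 1..X j}\<close>. The gap 3
  keeps this interval clear of all other blocks, so that the next step is a translation by
  -1.\<close>

locale block_seq =
  fixes X :: "nat \<Rightarrow> real" and \<kappa> :: "nat \<Rightarrow> real \<Rightarrow> real"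
  assumes prof: "profile (\<kappa> j)"
    and gap: "i < j \<Longrightarrow> X i + 3 \<le> X j"
    and big: "real j \<le> X j"
begin

text \<open>The map that skips the blocks below \<open>i\<close>. As \<open>j \<le> X j\<close>, all terms omitted from the sum vanish at \<open>t\<close>.\<close>

definition line_map :: "nat \<Rightarrow> real \<Rightarrow> real" where
  "line_map i t = t - 1 + (\<Sum>j\<in>{i..nat \<lceil>t\<rceil>}. bump (X j) (\<kappa> j) t)"

abbreviation half_blk :: "nat \<Rightarrow> real \<Rightarrow> real" where
  "half_blk i \<equiv> half_block (X i) (\<kappa> i)"

abbreviation half_prod :: "nat \<Rightarrow> nat \<Rightarrow> real \<Rightarrow> real" where
  "half_prod \<equiv> half_product (\<lambda>j. (X j, \<kappa> j))"

lemma mono_X: "i \<le> j \<Longrightarrow> X i \<le> X j"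
  using gap[of i j] by (cases "i = j") auto

text \<open>The upper limit of the sum can be any natural number above \<open>t\<close>, which gives
  one finite sum valid near a given point.\<close>

lemma line_map_alt:
  assumes "t \<le> real n" shows "line_map i t = t - 1 + (\<Sum>j\<in>{i..n}. bump (X j) (\<kappa> j) t)"
proof -
  have "(\<Sum>j\<in>{i..nat \<lceil>t\<rceil>}. bump (X j) (\<kappa> j) t) = (\<Sum>j\<in>{i..n}. bump (X j) (\<kappa> j) t)"
  proof (rule sum.mono_neutral_left)
    show "{i..nat \<lceil>t\<rceil>} \<subseteq> {i..n}" using assms by (auto simp: nat_le_iff ceiling_le_iff)
    show "\<forall>j\<in>{i..n} - {i..nat \<lceil>t\<rceil>}. bump (X j) (\<kappa> j) t = 0"
    proof
      fix j assume "j \<in> {i..n} - {i..nat \<lceil>t\<rceil>}"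
      then have "t \<le> real j" by (auto simp: not_le) linarith
      then show "bump (X j) (\<kappa> j) t = 0" using big[of j] by (intro bump_outside prof) auto
    qed
  qed simp
  then show ?thesis by (simp add: line_map_def)
qed

lemma continuous_line_map: "continuous_on A (line_map i)"
proof -
  have "isCont (line_map i) t" for t
  proof -
    obtain n where n: "t < real n" using reals_Archimedean2 by blast
    have "continuous_on {..<real n} (\<lambda>t. t - 1 + (\<Sum>j\<in>{i..n}. bump (X j) (\<kappa> j) t))"
      by (intro continuous_intros continuous_bump prof)
    then have "continuous_on {..<real n} (line_map i)"
      by (rule continuous_on_eq) (simp add: line_map_alt[of _ n])
    then show ?thesis using n by (simp add: continuous_on_eq_continuous_at)
  qed
  then show ?thesis by (intro continuous_at_imp_continuous_on) auto
qed

lemma line_map_block: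
  assumes "i \<le> j" "X j \<le> t" "t \<le> X j + 1"
  shows "line_map i t = X j + \<kappa> j (t - X j) - 1"
proof -
  obtain n where n: "t < real n" using reals_Archimedean2 by blast
  have jn: "j \<le> n" using big[of j] assms n by (auto intro: ccontr)
  have "(\<Sum>k\<in>{i..n}. bump (X k) (\<kappa> k) t) = (\<Sum>k\<in>{j}. bump (X k) (\<kappa> k) t)"
  proof (rule sum.mono_neutral_right)
    show "\<forall>k\<in>{i..n} - {j}. bump (X k) (\<kappa> k) t = 0"
    proof
      fix k assume "k \<in> {i..n} - {j}"
      then consider "k < j" | "j < k" by force
      then show "bump (X k) (\<kappa> k) t = 0"
        by cases (use gap[of k j] gap[of j k] assms in \<open>auto intro!: bump_outside prof\<close>)
    qed
  qed (use assms jn in auto)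
  also have "\<dots> = \<kappa> j (t - X j) - (t - X j)" using assms by (simp add: bump_def)
  finally show ?thesis using n by (simp add: line_map_alt[of t n])
qed

lemma line_map_off:
  assumes "\<And>j. i \<le> j \<Longrightarrow> t < X j \<or> X j + 1 < t"
  shows "line_map i t = t - 1"
proof -
  have "bump (X j) (\<kappa> j) t = 0" if "i \<le> j" for j
    using assms[OF that] by (intro bump_outside prof) auto
  then show ?thesis by (simp add: line_map_def)
qed

lemma line_map_cases:
  obtains (block) j where "i \<le> j" "X j \<le> t" "t \<le> X j + 1" "line_map i t = X j + \<kappa> j (t - X j) - 1"
    | (off) "\<And>j. i \<le> j \<Longrightarrow> t < X j \<or> X j + 1 < t" "line_map i t = t - 1"
  using line_map_block[of i _ t] line_map_off[of i t] by (metis leI)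

lemma \<kappa>_range: "0 \<le> u \<Longrightarrow> u \<le> 1 \<Longrightarrow> 0 \<le> \<kappa> j u" "0 \<le> u \<Longrightarrow> u \<le> 1 \<Longrightarrow> \<kappa> j u \<le> 1"
  using prof[of j] by (auto simp: profile_def image_subset_iff)

lemma \<kappa>_ends: "\<kappa> j 0 = 0" "\<kappa> j 1 = 1" using prof[of j] by (auto simp: profile_def)

lemma line_map_block_range:
  assumes "i \<le> j" "X j \<le> t" "t \<le> X j + 1"
  shows "X j - 1 \<le> line_map i t" "line_map i t \<le> X j"
  using \<kappa>_range[of "t - X j" j] assms by (auto simp: line_map_block)

lemma line_map_less: "line_map i t < t"
proof (cases rule: line_map_cases[of i t])
  case (block j)
  then show ?thesis
    using line_map_block_range(2)[of i j t] by (cases "t = X j") (auto simp: \<kappa>_ends)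
qed simp

lemma line_map_ge: "t - 2 \<le> line_map i t"
proof (cases rule: line_map_cases[of i t])
  case (block j)
  then show ?thesis using line_map_block_range(1)[of i j t] by auto
qed simp

text \<open>Inside a block a single step can lose arbitrarily little, but it ends in
  \<open>{X j - 1..X j}\<close>, where the next step is a translation by -1.\<close>

lemma line_map_twice: "line_map i (line_map i t) \<le> t - 1"
proof (cases rule: line_map_cases[of i t])
  case (block j)
  define s where "s = line_map i t"
  have s: "X j - 1 \<le> s" "s \<le> X j" unfolding s_def by (rule line_map_block_range[OF block(1-3)])+
  have "line_map i s \<le> t - 1"
  proof (cases "s = X j")
    case True
    then show ?thesis using block by (simp add: line_map_block[OF block(1)] \<kappa>_ends)
  next
    case False
    have "line_map i s = s - 1"
    proof (rule line_map_off)
      fix k assume "i \<le> k"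
      show "s < X k \<or> X k + 1 < s" using gap[of k j] gap[of j k] s False
        by (cases k j rule: linorder_cases) auto
    qed
    then show ?thesis using s block by simp
  qed
  then show ?thesis by (simp add: s_def)
next
  case off
  then show ?thesis using line_map_less[of i "t - 1"] by simp
qed

lemma line_map_iter_decr: "(line_map i ^^ (2 * m)) t \<le> t - real m"
proof (induction m)
  case (Suc m)
  then show ?case using line_map_twice[of i "(line_map i ^^ (2 * m)) t"] by simp
qed simp

lemma continuous_line_map_iter: "continuous_on A (line_map i ^^ m)"
proof (induction m)
  case (Suc m)
  then show ?case
    using continuous_on_compose[OF Suc continuous_line_map] by simp
qed (simp add: continuous_on_id id_def)

lemma half_blk_near: "\<bar>half_blk i t - t\<bar> \<le> 1"
  using block_map_near[OF prof] by (auto simp: half_block_def)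

lemma block_map_X: "block_map (X i) (\<kappa> i) (X i) = X i"
  using block_map_cut[OF prof, of "X i" i 0] by simp

lemma half_blk_above: "X i \<le> t \<Longrightarrow> half_blk i t = t"
  using block_map_X by (auto simp: half_block_def)

text \<open>
  A point above the block \<open>i\<close> is still going to pass it, a point below must be changed as if it had
  already passed it.
\<close>

lemma half_blk_semiconj: "line_map i (half_blk i t) = half_blk i (line_map (Suc i) t)"
proof -
  consider "t \<le> X i" | "X i < t" "t \<le> X i + 1" | "X i + 1 < t" by linarith
  then show ?thesis
  proof cases
    case 1
    have off: "line_map (Suc i) t = t - 1"
    proof (rule line_map_off)
      fix j assume "Suc i \<le> j"
      then show "t < X j \<or> X j + 1 < t" using gap[of i j] 1 by auto
    qed
    have p1: "block_map (X i) (\<kappa> i) (t - 1) = block_map (X i) (\<kappa> i) t - 1"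
      using block_map_add_int[of "X i" "\<kappa> i" t "-1"] by simp
    have le: "block_map (X i) (\<kappa> i) t \<le> X i"
    proof (cases "t = X i")
      case True then show ?thesis using block_map_X by simp
    next
      case False
      obtain k :: int where k: "X i + of_int k \<le> t" "t < X i + of_int k + 1" by (rule block_ex)
      have "block_map (X i) (\<kappa> i) t \<le> X i + of_int k + 1" using block_map_mem(2)[OF prof k(1)] k by auto
      moreover have "k < 0" using k False 1 by linarith
      then have "(of_int k :: real) + 1 \<le> 0" by linarith
      ultimately show ?thesis by linarith
    qed
    have "line_map i (block_map (X i) (\<kappa> i) t) = block_map (X i) (\<kappa> i) t - 1"
    proof (cases "block_map (X i) (\<kappa> i) t = X i")
      case True
      then show ?thesis using line_map_block[of i i "X i"] by (simp add: \<kappa>_ends)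
    next
      case False
      show ?thesis
      proof (rule line_map_off)
        fix j assume "i \<le> j"
        then show "block_map (X i) (\<kappa> i) t < X j \<or> X j + 1 < block_map (X i) (\<kappa> i) t"
          using mono_X[of i j] le False by auto
      qed
    qed
    then show ?thesis using 1 off p1 by (simp add: half_block_def)
  next
    \<comment> \<open>The block acts at once on the left and after the translation on the right;
      both agree because \<open>block_map\<close> commutes with integer translations.\<close>
    case 2
    have off: "line_map (Suc i) t = t - 1"
    proof (rule line_map_off)
      fix j assume "Suc i \<le> j"
      then show "t < X j \<or> X j + 1 < t" using gap[of i j] 2 by auto
    qed
    have "block_map (X i) (\<kappa> i) (t - 1) = block_map (X i) (\<kappa> i) t - 1"
      using block_map_add_int[of "X i" "\<kappa> i" t "-1"] by simp
    moreover have "block_map (X i) (\<kappa> i) t = X i + \<kappa> i (t - X i)"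
      using block_map_eq[OF prof, of "X i" 0 t i] 2 by simp
    ultimately show ?thesis using 2 off line_map_block[of i i t] by (simp add: half_block_def)
  next
    \<comment> \<open>Above the block the coordinate change is the identity, and also at the image,
      since a step from there does not get below \<open>X i\<close>.\<close>
    case 3
    have eq: "line_map i t = line_map (Suc i) t \<and> X i \<le> line_map (Suc i) t"
    proof (cases rule: line_map_cases[of "Suc i" t])
      case (block j)
      then show ?thesis using line_map_block[of i j t] line_map_block_range(1)[of "Suc i" j t] gap[of i j] by auto
    next
      case off
      have "line_map i t = t - 1"
      proof (rule line_map_off)
        fix j assume "i \<le> j"
        then show "t < X j \<or> X j + 1 < t" using off(1)[of j] 3 by (cases "i = j") auto
      qed
      then show ?thesis using off 3 by simp
    qed
    then show ?thesis using 3 half_blk_above by simp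
  qed
qed

lemma half_prod_near: "\<bar>half_prod a n t - t\<bar> \<le> real n"
proof (induction n arbitrary: t)
  case (Suc n)
  show ?case using Suc[of "half_blk (a + n) t"] half_blk_near[of "a + n" t] by simp
qed simp

lemma half_prod_semiconj: "line_map a (half_prod a n t) = half_prod a n (line_map (a + n) t)"
proof (induction n arbitrary: t)
  case (Suc n)
  then show ?case by (simp add: half_blk_semiconj)
qed simp

lemma half_prod_semiconj_iter: "(line_map a ^^ m) (half_prod a n t) = half_prod a n ((line_map (a + n) ^^ m) t)"
  by (induction m) (simp_all add: half_prod_semiconj)

lemma half_prod_above: "X (a + n) \<le> t \<Longrightarrow> half_prod a n t = t"
proof (induction n)
  case (Suc n)
  moreover have "X (a + n) \<le> X (a + Suc n)" by (rule mono_X) simp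
  ultimately show ?case by (simp add: half_blk_above)
qed simp

lemma half_prod_add: "half_prod a (m + n) t = half_prod a m (half_prod (a + m) n t)"
  by (induction n arbitrary: t) (simp_all add: add.assoc)

text \<open>Each factor moves a point by at most 1, so the point stays below all \<open>n\<close>
  blocks while they act, and there the half maps are the full block maps.\<close>

lemma half_prod_below: "t + real n \<le> X a \<Longrightarrow> half_prod a n t = block_product (\<lambda>j. (X j, \<kappa> j)) a n t"
proof (induction n arbitrary: t)
  case (Suc n)
  have "t \<le> X (a + n)" using Suc.prems mono_X[of a "a + n"] by auto
  then have 1: "half_blk (a + n) t = block_map (X (a + n)) (\<kappa> (a + n)) t" by (simp add: half_block_def)
  then have "half_blk (a + n) t + real n \<le> X a" using Suc.prems half_blk_near[of "a + n" t] by simp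
  from Suc.IH[OF this] show ?case using 1 by simp
qed simp

lemma block_product_near: "\<bar>block_product (\<lambda>j. (X j, \<kappa> j)) a n t - t\<bar> \<le> real n"
proof (induction n arbitrary: t)
  case (Suc n)
  show ?case using Suc[of "block_map (X (a + n)) (\<kappa> (a + n)) t"] block_map_near[OF prof, of "X (a + n)" "a + n" t] by simp
qed simp

text \<open>On points above \<open>X (a + n)\<close> the iterate is \<open>half_prod 0 a\<close>
  after \<open>half_prod a n\<close> after an iterate of the map without these blocks. If the final
  value is in \<open>{-S..S}\<close>, the middle factor acts as the block product, whose crookedness
  survives composition on both sides.\<close>

lemma crooked_pair_line_map_iter:
  assumes e: "e \<le> 1"
    and block_product: "\<And>c d. \<bar>block_product (\<lambda>j. (X j, \<kappa> j)) a n c - block_product (\<lambda>j. (X j, \<kappa> j)) a n d\<bar> \<le> 2 * (S + real a)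
         \<Longrightarrow> crooked_pair e (block_product (\<lambda>j. (X j, \<kappa> j)) a n) c d"
    and mod: "\<And>x y. \<bar>x\<bar> \<le> S + real a \<Longrightarrow> \<bar>x - y\<bar> < e \<Longrightarrow> \<bar>half_prod 0 a x - half_prod 0 a y\<bar> < \<delta>"
    and pos: "S + real a + 2 * real n + 1 \<le> X a"
    and c: "X (a + n) \<le> c" "\<bar>(line_map 0 ^^ m) c\<bar> \<le> S" and d: "X (a + n) \<le> d" "\<bar>(line_map 0 ^^ m) d\<bar> \<le> S"
  shows "crooked_pair \<delta> (line_map 0 ^^ m) c d"
proof -
  let ?P = "block_product (\<lambda>j. (X j, \<kappa> j)) a n"
  define w where "w = line_map (a + n) ^^ m"
  have eq: "(line_map 0 ^^ m) t = half_prod 0 a (half_prod a n (w t))" if "X (a + n) \<le> t" for t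
  proof -
    have "(line_map 0 ^^ m) t = (line_map 0 ^^ m) (half_prod 0 (a + n) t)" using half_prod_above[of 0 "a + n" t] that by simp
    also have "\<dots> = half_prod 0 (a + n) (w t)" using half_prod_semiconj_iter[where a = 0 and n = "a + n"] by (simp add: w_def)
    finally show ?thesis using half_prod_add[of 0 a n] by simp
  qed
  have flat_val: "half_prod a n (w t) = ?P (w t) \<and> \<bar>?P (w t)\<bar> \<le> S + real a"
    if "X (a + n) \<le> t" "\<bar>(line_map 0 ^^ m) t\<bar> \<le> S" for t
  proof -
    have 1: "\<bar>half_prod a n (w t)\<bar> \<le> S + real a"
      using eq[OF that(1)] that(2) half_prod_near[of 0 a "half_prod a n (w t)"] by linarith
    then have "w t + real n \<le> X a" using half_prod_near[of a n "w t"] pos by linarith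
    then show ?thesis using half_prod_below 1 by simp
  qed
  note vc = flat_val[OF c] and vd = flat_val[OF d]
  have "\<bar>?P (w c) - ?P (w d)\<bar> \<le> (S + real a) + (S + real a)"
    using conjunct2[OF vc] conjunct2[OF vd] by linarith
  then have "crooked_pair e ?P (w c) (w d)" by (intro block_product) simp
  then have crooked_pair: "crooked_pair e (?P \<circ> w) c d"
    by (intro crooked_pair_comp_right) (simp_all add: w_def continuous_line_map_iter)
  \<comment> \<open>Points between \<open>c\<close> and \<open>d\<close> may end outside
    \<open>{-S..S}\<close>; closeness within \<open>e \<le> 1\<close> after the block product still
    places \<open>w t\<close> below the blocks.\<close>
  have near: "\<bar>(line_map 0 ^^ m) x - (line_map 0 ^^ m) t\<bar> < \<delta>"
    if t: "t \<in> closed_segment c d" "\<bar>(?P \<circ> w) x - (?P \<circ> w) t\<bar> < e" 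
      and x: "X (a + n) \<le> x" "\<bar>(line_map 0 ^^ m) x\<bar> \<le> S" for x t
  proof -
    note vx = flat_val[OF x]
    have tX: "X (a + n) \<le> t" using t(1) c d by (auto simp: closed_segment_eq_real_ivl split: if_splits)
    have "w t + real n \<le> X a" using t(2) vx e block_product_near[of a n "w t"] pos by (simp add: o_def) linarith
    then have "half_prod a n (w t) = ?P (w t)" by (rule half_prod_below)
    then show ?thesis using mod[of "?P (w x)" "?P (w t)"] vx t(2) eq[OF x(1)] eq[OF tX] by simp
  qed
  show ?thesis by (rule crooked_pair_comp_left[OF crooked_pair]) (use near c d in auto)
qed

end

section \<open>Entropy and crookedness of interval maps\<close>

text \<open>One representative for each label that occurs gives a spanning set.\<close>

lemma spanning_number_le_labels:
  assumes fin: "finite L" and lab: "\<And>x. x \<in> X \<Longrightarrow> lab x \<in> L"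
    and close: "\<And>x y i. x \<in> X \<Longrightarrow> y \<in> X \<Longrightarrow> lab x = lab y \<Longrightarrow> i < n \<Longrightarrow> dist ((f ^^ i) x) ((f ^^ i) y) < \<epsilon>"
  shows "spanning_number X f n \<epsilon> \<le> card L"
proof -
  define E where "E = inv_into X lab ` (lab ` X)"
  have sub: "lab ` X \<subseteq> L" using lab by auto
  then have finX: "finite (lab ` X)" using fin finite_subset by blast
  have "spanning X f n \<epsilon> E"
    unfolding spanning_def
  proof (intro conjI ballI)
    show "E \<subseteq> X" unfolding E_def using inv_into_into[of _ lab X] by blast
    fix x assume x: "x \<in> X"
    define y where "y = inv_into X lab (lab x)"
    have lx: "lab x \<in> lab ` X" using x by simp
    have "y \<in> X" "lab y = lab x"
      unfolding y_def by (rule inv_into_into[OF lx], rule f_inv_into_f[OF lx])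
    moreover have "y \<in> E" unfolding E_def y_def using lx by (rule imageI)
    ultimately show "\<exists>y\<in>E. \<forall>i<n. dist ((f ^^ i) x) ((f ^^ i) y) < \<epsilon>"
      using x close by metis
  qed
  then have "spanning_number X f n \<epsilon> \<le> card E"
    unfolding spanning_number_def using finX by (intro cInf_lower) (auto simp: E_def)
  also have "\<dots> \<le> card (lab ` X)" unfolding E_def by (rule card_image_le[OF finX])
  also have "\<dots> \<le> card L" by (rule card_mono[OF fin sub])
  finally show ?thesis .
qed

lemma top_entropy_eq_0:
  assumes "\<And>\<epsilon>. 0 < \<epsilon> \<Longrightarrow> \<exists>C>0. \<forall>n. real (spanning_number X f n \<epsilon>) \<le> C * (real n + 1)"
  shows "top_entropy X f = 0"
proof -
  have "limsup (\<lambda>n. ereal (ln (real (spanning_number X f n \<epsilon>)) / real n)) = 0" if "0 < \<epsilon>" for \<epsilon>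
  proof -
    define s where "s n = spanning_number X f n \<epsilon>" for n
    obtain C where C: "0 < C" "\<And>n. real (s n) \<le> C * (real n + 1)" using assms[OF \<open>0 < \<epsilon>\<close>] by (auto simp: s_def)
    define D where "D = max C 1"
    have D: "1 \<le> D" "real (s n) \<le> D * (real n + 1)" for n
    proof -
      have "C * (real n + 1) \<le> D * (real n + 1)" by (intro mult_right_mono) (auto simp: D_def)
      then show "1 \<le> D" "real (s n) \<le> D * (real n + 1)" using C(2)[of n] unfolding D_def by linarith+
    qed
    have ln: "0 \<le> ln (real (s n)) \<and> ln (real (s n)) \<le> ln (D * (real n + 1))" for n
    proof (cases "s n = 0")
      \<comment> \<open>Here \<open>ln 0 = 0\<close> by convention, and the upper bound is
        nonnegative because \<open>D \<ge> 1\<close>.\<close>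
      case True
      have "1 * 1 \<le> D * (real n + 1)" by (intro mult_mono D) (use D in auto)
      then show ?thesis using True by simp
    next
      case False
      then show ?thesis using D(2)[of n] by simp
    qed
    have "(\<lambda>n. ln (real (s n)) / real n) \<longlonglongrightarrow> 0"
    proof (rule tendsto_sandwich[of "\<lambda>_. 0" _ _ "\<lambda>n. ln (D * (real n + 1)) / real n"])
      show "(\<lambda>n. ln (D * (real n + 1)) / real n) \<longlonglongrightarrow> 0" using D(1) by real_asymp
    qed (use ln in \<open>auto intro!: always_eventually divide_right_mono\<close>)
    then have "(\<lambda>n. ereal (ln (real (s n)) / real n)) \<longlonglongrightarrow> 0"
      by (simp add: zero_ereal_def)
    then show ?thesis unfolding s_def by (intro lim_imp_Limsup) auto
  qed
  then have "(SUP \<epsilon>\<in>{0<..}. limsup (\<lambda>n. ereal (ln (real (spanning_number X f n \<epsilon>)) / real n)))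
      = (SUP \<epsilon>\<in>{0<..} :: real set. 0)"
    by (intro SUP_cong) auto
  then show ?thesis unfolding top_entropy_def by simp
qed

text \<open>The first \<open>n\<close> iterates have a common modulus of uniform continuity, and
  finitely many balls of that radius cover the interval.\<close>

lemma finite_orbit_net:
  fixes f :: "real \<Rightarrow> real"
  assumes cont: "continuous_on I01 f" and maps: "f ` I01 \<subseteq> I01" and e: "0 < e"
  obtains E where "finite E" "\<And>x. x \<in> I01 \<Longrightarrow> \<exists>y\<in>E. \<forall>i<n. dist ((f ^^ i) x) ((f ^^ i) y) < e"
proof -
  have it: "(f ^^ i) ` I01 \<subseteq> I01 \<and> continuous_on I01 (f ^^ i)" for i
  proof (induction i)
    case (Suc i)
    then have "continuous_on I01 (f \<circ> (f ^^ i))"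
      using cont by (intro continuous_on_compose) (auto intro: continuous_on_subset)
    then show ?case using Suc maps by (auto simp: image_subset_iff)
  qed (simp add: id_def)
  have "\<exists>g>0. \<forall>i<n. \<forall>x\<in>I01. \<forall>y\<in>I01. dist x y < g \<longrightarrow> dist ((f ^^ i) x) ((f ^^ i) y) < e"
  proof (induction n)
    case (Suc n)
    then obtain g where g: "0 < g" "\<forall>i<n. \<forall>x\<in>I01. \<forall>y\<in>I01. dist x y < g \<longrightarrow> dist ((f ^^ i) x) ((f ^^ i) y) < e" by blast
    have "uniformly_continuous_on I01 (f ^^ n)" using it by (intro compact_uniformly_continuous) auto
    then obtain g' where g': "0 < g'" "\<forall>x\<in>I01. \<forall>y\<in>I01. dist y x < g' \<longrightarrow> dist ((f ^^ n) y) ((f ^^ n) x) < e"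
      unfolding uniformly_continuous_on_def using e by blast
    show ?case using g g' by (intro exI[of _ "min g g'"]) (auto simp: less_Suc_eq)
  qed (auto intro: exI[of _ 1])
  then obtain g where g: "0 < g" "\<forall>i<n. \<forall>x\<in>I01. \<forall>y\<in>I01. dist x y < g \<longrightarrow> dist ((f ^^ i) x) ((f ^^ i) y) < e" by blast
  obtain E where E: "finite E" "E \<subseteq> I01" "I01 \<subseteq> (\<Union>x\<in>E. ball x g)"
  proof (rule compactE_image[of I01 I01 "\<lambda>x. ball x g"])
    show "I01 \<subseteq> (\<Union>x\<in>I01. ball x g)" using g(1) by auto
  qed auto
  show ?thesis
  proof (rule that[OF E(1)])
    fix x :: real assume x: "x \<in> I01"
    then obtain y where "y \<in> E" "dist x y < g" using E(3) by (auto simp: dist_commute)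
    then show "\<exists>y\<in>E. \<forall>i<n. dist ((f ^^ i) x) ((f ^^ i) y) < e" using g(2) x E(2) by blast
  qed
qed

lemma crooked_pair_mono: "crooked_pair e f c d \<Longrightarrow> e \<le> e' \<Longrightarrow> crooked_pair e' f c d"
  by (erule crooked_pair_comp_left) auto

text \<open>Values in the end zones are replaced by the nearest value in
  \<open>{\<eta>..1 - \<eta>}\<close>, which is attained between \<open>c\<close> and
  \<open>d\<close>; extending the pair back costs \<open>\<eta>\<close>.\<close>

lemma delta_crookedI:
  assumes cont: "continuous_on I01 g" and maps: "g ` I01 \<subseteq> I01" and pos: "0 < \<delta>" "0 < \<eta>" "\<eta> \<le> 1 / 2"
    and mid: "\<And>c d. c \<in> I01 \<Longrightarrow> d \<in> I01 \<Longrightarrow> g c \<in> {\<eta>..1 - \<eta>} \<Longrightarrow> g d \<in> {\<eta>..1 - \<eta>} \<Longrightarrow> crooked_pair \<delta> g c d"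
  shows "delta_crooked (\<delta> + \<eta>) g"
proof -
  have "crooked_pair (\<delta> + \<eta>) g c d" if cd: "c \<in> I01" "d \<in> I01" for c d
  proof (cases "\<bar>g c - g d\<bar> < \<delta> + \<eta>")
    case True then show ?thesis by (rule crooked_pair_near)
  next
    case False
    define a b where "a = max \<eta> (min (1 - \<eta>) (g c))" and "b = max \<eta> (min (1 - \<eta>) (g d))"
    have gc: "0 \<le> g c" "g c \<le> 1" "0 \<le> g d" "g d \<le> 1" using maps cd by (auto simp: image_subset_iff)
    have sub: "closed_segment c d \<subseteq> I01" using cd by (auto simp: closed_segment_eq_real_ivl split: if_splits)
    \<comment> \<open>Two values at distance at least \<open>\<delta> + \<eta>\<close> do not lie in
      the same end zone, so the clipped values keep their order and lie between them.\<close>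
    have ab: "a \<in> closed_segment (g c) (g d)" "b \<in> closed_segment a (g d)"
      using False gc pos by (auto simp: a_def b_def closed_segment_eq_real_ivl min_def max_def split: if_splits)
    obtain u where u: "u \<in> closed_segment c d" "g u = a"
      using IVT'_closed_segment_real[of a g c d] ab(1) continuous_on_subset[OF cont sub] by blast
    have sub': "closed_segment u d \<subseteq> I01" using subset_closed_segment_real[OF u(1)] sub by blast
    obtain v where v: "v \<in> closed_segment u d" "g v = b"
      using IVT'_closed_segment_real[of b g u d] ab(2) u(2) continuous_on_subset[OF cont sub'] by blast
    have "crooked_pair \<delta> g u v"
      by (rule mid) (use u v sub sub' pos in \<open>auto simp: a_def b_def\<close>)
    then show ?thesis
      by (intro crooked_pair_extend[OF u(1) v(1)]) (use u v gc pos in \<open>auto simp: a_def b_def\<close>)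
  qed
  then show ?thesis by (simp add: delta_crooked_def crooked_between_iff_crooked_pair)
qed

section \<open>The logistic coordinate on the open interval\<close>

definition logi :: "real \<Rightarrow> real" where "logi t = 1 / (1 + exp (- t))"
definition logit :: "real \<Rightarrow> real" where "logit x = ln (x / (1 - x))"

lemma logi_range: "0 < logi t" "logi t < 1"
  by (auto simp: logi_def add_pos_pos)

lemma logi_less_iff [simp]: "logi s < logi t \<longleftrightarrow> s < t"
  by (auto simp: logi_def field_simps add_pos_pos)

lemma logi_le_iff [simp]: "logi s \<le> logi t \<longleftrightarrow> s \<le> t"
  using logi_less_iff[of t s] by linarith

lemma logit_logi [simp]: "logit (logi t) = t"
proof -
  have "1 + exp (- t) \<noteq> 0" using exp_gt_zero[of "- t"] by linarith
  then have "logi t / (1 - logi t) = exp t" by (simp add: logi_def field_simps exp_minus)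
  then show ?thesis by (simp add: logit_def)
qed

lemma logi_logit: "0 < x \<Longrightarrow> x < 1 \<Longrightarrow> logi (logit x) = x"
  by (simp add: logi_def logit_def exp_minus field_simps)

lemma logi_uminus: "logi (- t) = 1 - logi t"
proof -
  have "1 + exp t \<noteq> 0" using exp_gt_zero[of t] by linarith
  then show ?thesis by (simp add: logi_def field_simps exp_minus)
qed

text \<open>The derivative of \<open>logi\<close> is \<open>E / (1 + E)\<^sup>2\<close> with
  \<open>E = exp (- x)\<close>, which is at most 1; hence passing to the unit interval does not
  worsen the scale of crookedness.\<close>

lemma logi_lipschitz: "\<bar>logi s - logi t\<bar> \<le> \<bar>s - t\<bar>"
proof -
  have *: "logi t - logi s \<le> t - s" if "s \<le> t" for s t
  proof -
    have "s - logi s \<le> t - logi t"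
    proof (rule DERIV_nonneg_imp_nondecreasing[OF that])
      fix x :: real
      define E where "E = exp (- x)"
      have E: "0 < E" "1 + exp (- x) \<noteq> 0" using exp_gt_zero[of "- x"] unfolding E_def by linarith+
      have "((\<lambda>t. t - logi t) has_real_derivative 1 - E / (1 + E)\<^sup>2) (at x)"
        unfolding logi_def E_def
        by (rule derivative_eq_intros refl E(2))+ (simp add: power2_eq_square)
      moreover have "0 \<le> 1 - E / (1 + E)\<^sup>2" using E(1) by (simp add: divide_le_eq power2_eq_square algebra_simps)
      ultimately show "\<exists>y. ((\<lambda>t. t - logi t) has_real_derivative y) (at x) \<and> 0 \<le> y" by blast
    qed
    then show ?thesis by linarith
  qed
  show ?thesis using *[of s t] *[of t s] logi_le_iff[of s t] logi_le_iff[of t s] by linarith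
qed

lemma continuous_logi: "continuous_on A logi"
proof -
  have "1 + exp (- t) \<noteq> 0" for t :: real using exp_gt_zero[of "- t"] by linarith
  then show ?thesis unfolding logi_def by (intro continuous_intros) auto
qed

lemma continuous_logit: "A \<subseteq> {0<..<1} \<Longrightarrow> continuous_on A logit"
  unfolding logit_def by (rule continuous_on_ln) (auto intro!: continuous_intros)

lemma logi_small:
  assumes "0 < e" obtains T where "0 \<le> T" "\<And>t. T \<le> t \<Longrightarrow> logi (- t) < e"
proof -
  define T where "T = 1 / e"
  have "logi (- t) < e" if "T \<le> t" for t
  proof -
    have "1 / e < 1 + exp t" using exp_ge_add_one_self[of t] that unfolding T_def by linarith
    moreover have "0 < 1 + exp t" using exp_gt_zero[of t] by linarith
    ultimately show ?thesis using assms by (simp add: logi_def field_simps)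
  qed
  then show ?thesis using that[of T] assms by (simp add: T_def)
qed

section \<open>The map of the unit interval, its crookedness and its entropy\<close>

context block_seq
begin

definition unit_map :: "real \<Rightarrow> real" where
  "unit_map x = (if 0 < x \<and> x < 1 then logi (line_map 0 (logit x)) else x)"

lemma unit_map_logi: "unit_map (logi t) = logi (line_map 0 t)"
  by (simp add: unit_map_def logi_range)

lemma unit_map_iter_logi: "(unit_map ^^ m) (logi t) = logi ((line_map 0 ^^ m) t)"
  by (induction m) (simp_all add: unit_map_logi)

lemma unit_map_ends [simp]: "unit_map 0 = 0" "unit_map 1 = 1" by (simp_all add: unit_map_def)

lemma unit_map_iter_ends [simp]: "(unit_map ^^ m) 0 = 0" "(unit_map ^^ m) 1 = 1"
  by (induction m) simp_all

lemma I01_cases: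
  assumes "x \<in> I01" obtains "x = 0" | "x = 1" | t where "x = logi t"
  using assms logi_logit[of x] by (metis atLeastAtMost_iff less_eq_real_def)

lemma unit_map_less: "0 < x \<Longrightarrow> x < 1 \<Longrightarrow> unit_map x < x"
  using logi_logit[of x] line_map_less[of 0 "logit x"] by (metis unit_map_logi logi_less_iff)

lemma unit_map_le: "x \<in> I01 \<Longrightarrow> unit_map x \<le> x"
  using unit_map_less[of x] by (auto simp: unit_map_def)

lemma unit_map_mem: "x \<in> I01 \<Longrightarrow> unit_map x \<in> I01"
  using logi_range[of "line_map 0 (logit x)"] by (auto simp: unit_map_def)

lemma unit_map_iter_mem: "x \<in> I01 \<Longrightarrow> (unit_map ^^ m) x \<in> I01"
  by (induction m) (auto simp del: atLeastAtMost_iff intro: unit_map_mem)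

text \<open>A step lowers the logistic coordinate by at most 2, which multiplies the distance to 1
  by at most \<open>exp 2\<close>; this yields continuity at 1.\<close>

lemma unit_map_near_1:
  assumes x: "x \<in> I01" shows "1 - unit_map x \<le> exp 2 * (1 - x)"
  using x
proof (cases rule: I01_cases)
  case (3 t)
  have pos: "0 < 1 + exp s" for s :: real using exp_gt_zero[of s] by linarith
  have "1 - unit_map x \<le> 1 - logi (t - 2)" using line_map_ge[of t 0] 3 by (simp add: unit_map_logi)
  also have "\<dots> = 1 / (1 + exp (t - 2))" using logi_uminus[of "t - 2"] by (simp add: logi_def)
  also have "\<dots> \<le> exp 2 * (1 / (1 + exp t))"
  proof -
    have "1 + exp t \<le> exp 2 * (1 + exp (t - 2))" by (simp add: distrib_left exp_add[symmetric])
    then show ?thesis using pos[of t] pos[of "t - 2"] by (simp add: field_simps)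
  qed
  also have "1 / (1 + exp t) = 1 - x" using logi_uminus[of t] 3 by (simp add: logi_def)
  finally show ?thesis .
qed auto

lemma continuous_unit_map: "continuous_on I01 unit_map"
proof -
  have open_part: "continuous_on {0<..<1} unit_map"
  proof -
    have "continuous_on {0<..<1} (logi \<circ> (line_map 0 \<circ> logit))"
      by (intro continuous_on_compose continuous_logi continuous_line_map continuous_logit) simp
    then show ?thesis by (rule continuous_on_eq) (simp add: unit_map_def)
  qed
  have "continuous (at x within I01) unit_map" if x: "x \<in> I01" for x
  proof -
    consider "x = 0" | "x = 1" | "0 < x" "x < 1" using x by fastforce
    then show ?thesis
    proof cases
      case 1
      have "(unit_map \<longlongrightarrow> 0) (at 0 within I01)"
      proof (rule tendsto_sandwich[of "\<lambda>_. 0" _ _ "\<lambda>x. x"])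
        show "\<forall>\<^sub>F x in at 0 within I01. 0 \<le> unit_map x" using unit_map_mem by (auto simp: eventually_at_filter)
        show "\<forall>\<^sub>F x in at 0 within I01. unit_map x \<le> x" using unit_map_le by (auto simp: eventually_at_filter)
      qed auto
      then show ?thesis using 1 by (simp add: continuous_within)
    next
      case 2
      have "(unit_map \<longlongrightarrow> 1) (at 1 within I01)"
      proof (rule tendsto_sandwich[of "\<lambda>x. 1 - exp 2 * (1 - x)" _ _ "\<lambda>_. 1"])
        show "\<forall>\<^sub>F x in at 1 within I01. 1 - exp 2 * (1 - x) \<le> unit_map x"
          using unit_map_near_1 by (auto simp: eventually_at_filter algebra_simps)
        show "\<forall>\<^sub>F x in at 1 within I01. unit_map x \<le> 1" using unit_map_mem by (auto simp: eventually_at_filter)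
        show "((\<lambda>x. 1 - exp 2 * (1 - x)) \<longlongrightarrow> 1) (at 1 within I01)" by (auto intro!: tendsto_eq_intros)
      qed auto
      then show ?thesis using 2 by (simp add: continuous_within)
    next
      case 3
      then have "isCont unit_map x" using open_part by (simp add: continuous_on_eq_continuous_at)
      then show ?thesis by (rule continuous_at_imp_continuous_at_within)
    qed
  qed
  then show ?thesis by (simp add: continuous_on_eq_continuous_within)
qed

lemma interval_map_unit_map: "interval_map unit_map"
  unfolding interval_map_def
proof (intro conjI continuous_unit_map subset_antisym image_subsetI unit_map_mem subsetI)
  fix y :: real assume "y \<in> I01"
  then obtain x where "0 \<le> x" "x \<le> 1" "unit_map x = y"
    using IVT'[of unit_map 0 y 1] continuous_unit_map by auto
  then show "y \<in> unit_map ` I01" by auto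
qed

lemma card_fix_unit_map: "card {x \<in> I01. unit_map x = x} = 2"
proof -
  have "x = 0 \<or> x = 1" if "x \<in> I01" "unit_map x = x" for x
    using unit_map_less[of x] that unfolding atLeastAtMost_iff by linarith
  then have "{x \<in> I01. unit_map x = x} = {0, 1}" by auto
  then show ?thesis by simp
qed

lemma continuous_unit_map_iter: "continuous_on I01 (unit_map ^^ m)"
proof (induction m)
  case (Suc m)
  have "continuous_on ((unit_map ^^ m) ` I01) unit_map"
    by (rule continuous_on_subset[OF continuous_unit_map]) (use unit_map_iter_mem in blast)
  then show ?case using continuous_on_compose[OF Suc] by simp
qed (simp add: id_def)

text \<open>It suffices to treat pairs with final values in \<open>{\<eta>..1 - \<eta>}\<close>. On
  the line these values lie in \<open>{-S..S}\<close>, and at a late enough time such points must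
  have started beyond the blocks of the stage for \<open>S\<close>.\<close>

lemma crooked_unit_map:
  assumes "\<And>S. \<exists>p n. crooked_stage S p n (\<lambda>j. (X j, \<kappa> j))"
  shows "crooked unit_map"
  unfolding crooked_def
proof (intro allI impI)
  fix \<delta> :: real assume \<delta>: "0 < \<delta>"
  define \<eta> where "\<eta> = min (\<delta> / 2) (1 / 2)"
  have \<eta>: "0 < \<eta>" "\<eta> \<le> 1 / 2" "\<eta> \<le> \<delta> / 2" using \<delta> by (auto simp: \<eta>_def)
  obtain T where T: "\<And>t. T \<le> t \<Longrightarrow> logi (- t) < \<eta>" using logi_small[OF \<eta>(1)] by blast
  obtain S :: nat where S: "max T (2 / \<delta>) < real S" using reals_Archimedean2 by blast
  then have S1: "logi (- real S) < \<eta>" using T by simp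
  have S2: "1 / (real S + 1) \<le> \<delta> / 2" using S \<delta> by (auto simp: field_simps)
  obtain a n e where *: "e \<le> 1"
     "\<And>c d. \<bar>block_product (\<lambda>j. (X j, \<kappa> j)) a n c - block_product (\<lambda>j. (X j, \<kappa> j)) a n d\<bar> \<le> 2 * (real S + real a)
         \<Longrightarrow> crooked_pair e (block_product (\<lambda>j. (X j, \<kappa> j)) a n) c d"
     "\<And>x y. \<bar>x\<bar> \<le> real S + real a \<Longrightarrow> \<bar>x - y\<bar> < e \<Longrightarrow> \<bar>half_prod 0 a x - half_prod 0 a y\<bar> < 1 / (real S + 1)"
     "real S + real a + 2 * real n + 1 \<le> X a"
    using assms[of S] unfolding crooked_stage_def fst_conv by blast
  \<comment> \<open>\<open>2 * m0\<close> steps lower every point by at least \<open>m0\<close>, so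
    a point that ends at or above \<open>- S\<close> started above \<open>X (a + n)\<close>.\<close>
  obtain m0 :: nat where m0: "X (a + n) + real S < real m0" using reals_Archimedean2 by blast
  define m where "m = 2 * m0"
  have "delta_crooked (\<delta> / 2 + \<eta>) (unit_map ^^ m)"
  proof (rule delta_crookedI[OF continuous_unit_map_iter])
    show "(unit_map ^^ m) ` I01 \<subseteq> I01" using unit_map_iter_mem by blast
    have coord: "\<exists>t. x = logi t \<and> X (a + n) \<le> t \<and> \<bar>(line_map 0 ^^ m) t\<bar> \<le> real S"
      if x: "x \<in> I01" "(unit_map ^^ m) x \<in> {\<eta>..1 - \<eta>}" for x
    proof -
      have "x \<noteq> 0" "x \<noteq> 1" using x \<eta> by (auto)
      then obtain t where t: "x = logi t" using I01_cases[OF x(1)] by blast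
      have "logi (- real S) < logi ((line_map 0 ^^ m) t)" "logi ((line_map 0 ^^ m) t) < logi (real S)"
        using x(2) S1 logi_uminus[of "real S"] unfolding t unit_map_iter_logi atLeastAtMost_iff by linarith+
      then have 1: "\<bar>(line_map 0 ^^ m) t\<bar> \<le> real S" by simp
      moreover have "X (a + n) \<le> t"
        using line_map_iter_decr[of m0 0 t] 1 m0 unfolding m_def by linarith
      ultimately show ?thesis using t by blast
    qed
    fix c d :: real
    assume c: "c \<in> I01" "(unit_map ^^ m) c \<in> {\<eta>..1 - \<eta>}" and d: "d \<in> I01" "(unit_map ^^ m) d \<in> {\<eta>..1 - \<eta>}"
    obtain s where s: "c = logi s" "X (a + n) \<le> s" "\<bar>(line_map 0 ^^ m) s\<bar> \<le> real S" using coord[OF c] by blast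
    obtain t where t: "d = logi t" "X (a + n) \<le> t" "\<bar>(line_map 0 ^^ m) t\<bar> \<le> real S" using coord[OF d] by blast
    have "crooked_pair (1 / (real S + 1)) (line_map 0 ^^ m) s t"
      by (rule crooked_pair_line_map_iter[OF *(1) *(2) *(3) *(4)]) (use s t in auto)
    then have "crooked_pair (1 / (real S + 1)) (logi \<circ> (line_map 0 ^^ m)) (logit c) (logit d)"
      unfolding s t logit_logi
      by (rule crooked_pair_comp_left) (use logi_lipschitz in \<open>auto intro: le_less_trans\<close>)
    note crooked_pair = this
    have sub: "closed_segment c d \<subseteq> {0<..<1}"
      using logi_range[of s] logi_range[of t] s t by (auto simp: closed_segment_eq_real_ivl split: if_splits)
    have "crooked_pair (1 / (real S + 1)) ((logi \<circ> (line_map 0 ^^ m)) \<circ> logit) c d"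
      by (rule crooked_pair_comp_right[OF continuous_logit[OF sub] crooked_pair])
    moreover have "(unit_map ^^ m) x = ((logi \<circ> (line_map 0 ^^ m)) \<circ> logit) x" if "x \<in> closed_segment c d" for x
    proof -
      have "x = logi (logit x)" using that sub logi_logit[of x] by auto
      then have "(unit_map ^^ m) x = (unit_map ^^ m) (logi (logit x))" by simp
      then show ?thesis by (simp add: unit_map_iter_logi)
    qed
    ultimately show "crooked_pair (\<delta> / 2) (unit_map ^^ m) c d"
      using S2 by (elim crooked_pair_comp_left) auto
  qed (use \<delta> \<eta> in auto)
  then have "delta_crooked \<delta> (unit_map ^^ m)"
    using crooked_pair_mono[of "\<delta> / 2 + \<eta>" _ _ _ \<delta>] \<eta>(3)
    unfolding delta_crooked_def crooked_between_iff_crooked_pair by force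
  then show "\<exists>n. delta_crooked \<delta> (unit_map ^^ n)" by blast
qed

text \<open>
  An orbit is determined up to \<open>e\<close> by the time at which it leaves the neighbourhood of 1 and by a point
  of a finite net close to it at that time.
\<close>

lemma top_entropy_unit_map: "top_entropy I01 unit_map = 0"
proof (rule top_entropy_eq_0)
  fix e :: real assume e: "0 < e"
  obtain T where T: "0 \<le> T" "logi (- T) < e" using logi_small[OF e] by blast
  \<comment> \<open>The descent from \<open>T\<close> to \<open>- T\<close> takes at most
    \<open>2 * N0\<close> steps, since two steps lose at least 1.\<close>
  obtain N0 :: nat where N0: "2 * T < real N0" using reals_Archimedean2 by blast
  define N where "N = 2 * N0"
  obtain E where E: "finite E" "\<And>x. x \<in> I01 \<Longrightarrow> \<exists>y\<in>E. \<forall>i<N. dist ((unit_map ^^ i) x) ((unit_map ^^ i) y) < e / 2"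
  proof (rule finite_orbit_net[OF continuous_unit_map, of "e / 2" N])
    show "unit_map ` I01 \<subseteq> I01" using unit_map_mem by blast
  qed (use e in auto)
  define net where "net x = (SOME y. y \<in> E \<and> (\<forall>i<N. dist ((unit_map ^^ i) x) ((unit_map ^^ i) y) < e / 2))" for x
  have net: "net x \<in> E \<and> (\<forall>i<N. dist ((unit_map ^^ i) x) ((unit_map ^^ i) (net x)) < e / 2)" if "x \<in> I01" for x
    unfolding net_def by (rule someI_ex) (use E(2)[OF that] in blast)
  have antimono: "(unit_map ^^ j) x \<le> (unit_map ^^ i) x" if "i \<le> j" "x \<in> I01" for i j x
    using that(1)
  proof (induction j rule: dec_induct)
    case (step j)
    then show ?case using unit_map_le[OF unit_map_iter_mem[OF that(2)], of j] by simp
  qed simp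
  have low: "(unit_map ^^ k) x < e" if "N \<le> k" "x \<in> I01" "x \<le> logi T" for k x
  proof -
    have "(unit_map ^^ N) x < e" using that(2)
    proof (cases rule: I01_cases)
      case 2 then show ?thesis using that(3) logi_range[of T] by simp
    next
      case (3 t)
      have "(line_map 0 ^^ N) t \<le> - T" using line_map_iter_decr[of N0 0 t] that(3) 3 N0 by (simp add: N_def)
      then have "logi ((line_map 0 ^^ N) t) \<le> logi (- T)" by simp
      then have "logi ((line_map 0 ^^ N) t) < e" using T(2) by (rule le_less_trans)
      then show ?thesis using 3 by (simp add: unit_map_iter_logi)
    qed (use e in simp)
    then show ?thesis using antimono[OF that(1,2)] by simp
  qed
  have bound: "spanning_number I01 unit_map n e \<le> card ({..n} \<times> E)" for n
  proof -
    \<comment> \<open>The first time at which the orbit is at or below \<open>logi T\<close>, capped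
      at \<open>n\<close>; before it the orbit stays within \<open>e\<close> of 1.\<close>
    define J where "J x = (LEAST j. j = n \<or> (unit_map ^^ j) x \<le> logi T)" for x
    have J: "J x \<le> n" "J x = n \<or> (unit_map ^^ J x) x \<le> logi T" for x
      using LeastI[of "\<lambda>j. j = n \<or> (unit_map ^^ j) x \<le> logi T" n] Least_le[of "\<lambda>j. j = n \<or> (unit_map ^^ j) x \<le> logi T" n]
      unfolding J_def by auto
    have high: "1 - e < (unit_map ^^ i) x" if "i < J x" for i x
      using not_less_Least[OF that[unfolded J_def]] T logi_uminus[of T] by auto
    show ?thesis
    proof (rule spanning_number_le_labels[where lab = "\<lambda>x. (J x, net ((unit_map ^^ J x) x))"])
      show "finite ({..n} \<times> E)" using E by simp
      fix x :: real assume x: "x \<in> I01"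
      show "(J x, net ((unit_map ^^ J x) x)) \<in> {..n} \<times> E" using J net[OF unit_map_iter_mem[OF x]] by simp
      fix y :: real and i assume y: "y \<in> I01" and i: "i < n"
        and same: "(J x, net ((unit_map ^^ J x) x)) = (J y, net ((unit_map ^^ J y) y))"
      note mem = unit_map_iter_mem[OF x] unit_map_iter_mem[OF y]
      show "dist ((unit_map ^^ i) x) ((unit_map ^^ i) y) < e"
      proof (cases "i < J x")
        case True
        then show ?thesis using high[of i x] high[of i y] same mem[of i] by (auto simp: dist_real_def)
      next
        case False
        define k u v where "k = i - J x" and "u = (unit_map ^^ J x) x" and "v = (unit_map ^^ J y) y"
        have iu: "(unit_map ^^ i) x = (unit_map ^^ k) u" "(unit_map ^^ i) y = (unit_map ^^ k) v"
          using False same unfolding k_def u_def v_def by (auto simp: funpow_add[symmetric, THEN fun_cong, unfolded o_apply])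
        have uv: "u \<in> I01" "v \<in> I01" "u \<le> logi T" "v \<le> logi T" "net u = net v"
          using mem J[of x] J[of y] False i same unfolding u_def v_def by auto
        show ?thesis
        proof (cases "k < N")
          \<comment> \<open>The net point is followed for \<open>N\<close> steps; after that both
            orbits lie below \<open>e\<close>.\<close>
          case True
          then have "dist ((unit_map ^^ k) u) ((unit_map ^^ k) (net u)) < e / 2" "dist ((unit_map ^^ k) v) ((unit_map ^^ k) (net u)) < e / 2"
            using net[OF uv(1)] net[OF uv(2)] uv(5) by auto
          then show ?thesis unfolding iu by (rule dist_triangle_half_l)
        next
          case False
          then show ?thesis unfolding iu
            using low[of k u] low[of k v] uv unit_map_iter_mem[OF uv(1), of k] unit_map_iter_mem[OF uv(2), of k]
            by (auto simp: dist_real_def)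
        qed
      qed
    qed
  qed
  have "real (spanning_number I01 unit_map n e) \<le> (real (card E) + 1) * (real n + 1)" for n
  proof -
    have "real (spanning_number I01 unit_map n e) \<le> real (Suc n * card E)"
      using bound[of n] by (metis card_atMost card_cartesian_product of_nat_mono)
    also have "\<dots> \<le> (real (card E) + 1) * (real n + 1)" by (simp add: algebra_simps)
    finally show ?thesis .
  qed
  then show "\<exists>C>0. \<forall>n. real (spanning_number I01 unit_map n e) \<le> C * (real n + 1)"
    by (intro exI[of _ "real (card E) + 1"]) auto
qed

end

section \<open>An invariant of conjugacy\<close>

text \<open>Both profiles have height 1/2 on \<open>{1/2..2/3}\<close>. For \<open>False\<close> the
  level of 1/2 is the single interval \<open>{1/3..2/3}\<close>; for \<open>True\<close> the profile
  first rises to 3/4 and comes back, which adds the isolated point 1/6 to the interval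
  \<open>{1/2..3/4}\<close>.\<close>

definition mark :: "bool \<Rightarrow> real \<Rightarrow> real" where
  "mark b u = (if b then max (min (3 * u) (max (1 - u) (1 / 2))) (2 * u - 1)
     else max (min (3 * u / 2) (1 / 2)) ((3 * u - 1) / 2))"

lemma mark_True: "mark True u = max (min (3 * u) (max (1 - u) (1 / 2))) (2 * u - 1)"
  and mark_False: "mark False u = max (min (3 * u / 2) (1 / 2)) ((3 * u - 1) / 2)"
  by (simp_all add: mark_def)

lemma mark_True_pieces:
  assumes "0 \<le> u"
  shows "mark True u = (if u \<le> 1/4 then 3 * u else if u \<le> 1/2 then 1 - u
    else if u \<le> 3/4 then 1/2 else 2 * u - 1)"
proof -
  consider "u \<le> 1/4" | "1/4 < u" "u \<le> 1/2" | "1/2 < u" "u \<le> 3/4" | "3/4 < u" by linarith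
  then show ?thesis by cases (use assms in \<open>simp_all add: mark_True min_def max_def\<close>)
qed

lemma mark_False_pieces:
  "mark False u = (if u \<le> 1/3 then 3 * u / 2 else if u \<le> 2/3 then 1/2 else (3 * u - 1) / 2)"
proof -
  consider "u \<le> 1/3" | "1/3 < u" "u \<le> 2/3" | "2/3 < u" by linarith
  then show ?thesis by cases (simp_all add: mark_False min_def max_def)
qed

lemma profile_mark: "profile (mark b)"
proof -
  have "continuous_on {0..1} (mark b)"
    by (cases b rule: bool.exhaust; simp only: mark_True[abs_def] mark_False[abs_def]) (intro continuous_intros; simp)+
  moreover have "0 \<le> mark b u \<and> mark b u \<le> 1" if "0 \<le> u" "u \<le> 1" for u
    using that by (cases b rule: bool.exhaust) (simp_all add: mark_True_pieces mark_False_pieces)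
  moreover have "mark b 0 = 0" "mark b 1 = 1" by (cases b; simp add: mark_True mark_False)+
  ultimately show ?thesis by (auto simp: profile_def)
qed

lemma mark_flat:
  assumes "u \<in> {1/2..2/3}" shows "mark b u = 1 / 2"
  using assms by (cases b rule: bool.exhaust) (auto simp: mark_True_pieces mark_False_pieces)

lemma mark_steep:
  assumes "0 \<le> u"
  shows "mark b u = 1 / 2 \<or> mark b u = (if b then 3 * u else 3 * u / 2) \<or>
   mark b u = (if b then 1 - u else 3 * u / 2) \<or> mark b u = (if b then 2 * u - 1 else (3 * u - 1) / 2)"
  using assms by (cases b rule: bool.exhaust) (simp_all add: mark_True_pieces mark_False_pieces)

text \<open>Off the height 1/2 the graph lies on three lines of nonzero slope, or two for
  \<open>False\<close>, and each line meets a given height once. This is too few for four,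
  respectively three, points of an interval.\<close>

lemma mark_flat_only:
  assumes "0 \<le> u" "u < v" "v \<le> 1" and const: "\<And>w. w \<in> {u..v} \<Longrightarrow> mark b w = k"
  shows "k = 1 / 2"
proof (rule ccontr)
  assume k: "k \<noteq> 1 / 2"
  define m where "m = (u + v) / 2"
  define l where "l = (u + m) / 2"
  have ord: "u < l" "l < m" "m < v" using assms by (auto simp: m_def l_def)
  then have eq: "mark b u = k" "mark b l = k" "mark b m = k" "mark b v = k" using assms by auto
  have "0 \<le> l" "0 \<le> m" "0 \<le> v" using ord assms(1) by auto
  note steep = mark_steep[OF assms(1), of b] this[THEN mark_steep, of b]
  show False
  proof (cases b)
    case True
    have "k = 3 * w \<or> k = 1 - w \<or> k = 2 * w - 1" if "w \<in> {u, l, m, v}" for w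
      using steep k that unfolding eq by (auto simp: True)
    from this[of u] this[of l] this[of m] this[of v] show False
      using ord by (smt (verit) insert_iff)
  next
    case False
    have "2 * k = 3 * w \<or> 2 * k = 3 * w - 1" if "w \<in> {u, l, m}" for w
      using steep k that unfolding eq by (auto simp: False)
    from this[of u] this[of l] this[of m] show False
      using ord by (smt (verit) insert_iff)
  qed
qed

lemma mark_False_level:
  assumes "0 \<le> u" "u \<le> 1" shows "mark False u = 1 / 2 \<longleftrightarrow> u \<in> {1/3..2/3}"
  using assms by (auto simp: mark_False_pieces)

lemma mark_True_level: "mark True (1/6) = 1 / 2" "mark True (1/2) = 1 / 2" "mark True (1/4) \<noteq> 1 / 2"
  by (simp_all add: mark_True)

text \<open>Nondegenerate connected sets stand for intervals of constancy, because homeomorphisms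
  preserve them directly.\<close>

definition flat_vals :: "(real \<Rightarrow> real) \<Rightarrow> real set" where
  "flat_vals f = {y. \<exists>C. C \<subseteq> I01 \<and> connected C \<and> (\<exists>a\<in>C. \<exists>b\<in>C. a \<noteq> b) \<and> (\<forall>x\<in>C. f x = y)}"

definition level :: "(real \<Rightarrow> real) \<Rightarrow> real \<Rightarrow> real set" where
  "level f y = {x \<in> I01. f x = y}"

text \<open>If \<open>c n < d n\<close> with equal earlier entries, the value \<open>c n\<close>
  could only be some \<open>d m\<close> with \<open>m < n\<close>, but that is
  \<open>c m\<close>.\<close>

lemma strict_mono_range_eq:
  fixes a b :: "nat \<Rightarrow> real"
  assumes "strict_mono a" "strict_mono b" "range a = range b"
  shows "a n = b n"
proof (induction n rule: less_induct)
  case (less n)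
  have *: "d n \<le> c n" if asm: "strict_mono c" "strict_mono d" "range c = range d" "\<forall>k<n. c k = d k" for c d :: "nat \<Rightarrow> real"
  proof -
    obtain m where m: "c n = d m" using asm(3) by (metis rangeE rangeI)
    have "\<not> m < n" using m asm(1,4) by (metis strict_mono_eq less_irrefl)
    then show ?thesis using m asm(2) by (simp add: strict_mono_less_eq)
  qed
  show ?case using *[of a b] *[of b a] assms less by (simp add: order_antisym)
qed

section \<open>Transport of levels and flat values by a conjugacy\<close>

context
  fixes f g h h' :: "real \<Rightarrow> real"
  assumes hom: "homeomorphism I01 I01 h h'" and conj: "\<And>x. x \<in> I01 \<Longrightarrow> g x = h (f (h' x))"
    and fI: "f ` I01 \<subseteq> I01"
begin

lemma conj_eq: "x \<in> I01 \<Longrightarrow> g (h x) = h (f x)"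
  using hom conj[of "h x"] unfolding homeomorphism_def by (metis image_eqI)

lemma conj_inj: "inj_on h I01"
  using hom unfolding homeomorphism_def by (metis inj_on_inverseI)

lemma conj_image: "h ` I01 = I01" and conj_cont: "continuous_on I01 h"
  using hom unfolding homeomorphism_def by auto

lemma level_conj: "y \<in> I01 \<Longrightarrow> level g (h y) = h ` level f y"
proof (intro subset_antisym subsetI)
  fix z assume y: "y \<in> I01" and z: "z \<in> level g (h y)"
  then have "z \<in> h ` I01" unfolding conj_image by (simp add: level_def)
  then obtain x where x: "x \<in> I01" "z = h x" by blast
  then have "h (f x) = h y" using z conj_eq by (simp add: level_def)
  then have "f x = y" using conj_inj x y fI by (meson image_subset_iff inj_onD)
  then show "z \<in> h ` level f y" using x by (auto simp: level_def)
next
  fix z assume y: "y \<in> I01" and "z \<in> h ` level f y"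
  then show "z \<in> level g (h y)" using conj_eq conj_image by (auto simp: level_def)
qed

lemma connected_level_conj:
  assumes "y \<in> I01" shows "connected (level f y) \<Longrightarrow> connected (level g (h y))"
  unfolding level_conj[OF assms]
  by (intro connected_continuous_image continuous_on_subset[OF conj_cont]) (auto simp: level_def)

lemma flat_vals_conj: "h ` flat_vals f \<subseteq> flat_vals g"
proof (rule image_subsetI)
  fix y assume "y \<in> flat_vals f"
  then obtain C a b where C: "C \<subseteq> I01" "connected C" "a \<in> C" "b \<in> C" "a \<noteq> b" "\<forall>x\<in>C. f x = y"
    by (auto simp: flat_vals_def)
  have "connected (h ` C)" by (intro connected_continuous_image continuous_on_subset[OF conj_cont] C)
  moreover have "h a \<noteq> h b" using conj_inj C by (meson inj_onD subsetD)
  moreover have "\<forall>x\<in>h ` C. g x = h y" using C conj_eq by auto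
  moreover have "h ` C \<subseteq> I01" using C conj_image by blast
  ultimately show "h y \<in> flat_vals g" unfolding flat_vals_def using C(3,4) by blast
qed

text \<open>Both maps move interior points towards 0, so a conjugacy cannot exchange the ends: an
  order-reversing one would turn a downward step of \<open>f\<close> into an upward step of
  \<open>g\<close>.\<close>

lemma conj_strict_mono:
  assumes f: "f 0 = 0" "f 1 = 1" "\<And>x. 0 < x \<Longrightarrow> x < 1 \<Longrightarrow> f x < x"
    and g: "g 0 = 0" "g 1 = 1" "\<And>x. 0 < x \<Longrightarrow> x < 1 \<Longrightarrow> g x < x"
    and xy: "x \<in> I01" "y \<in> I01" "x < y"
  shows "h x < h y"
proof -
  have hI: "h x \<in> I01" if "x \<in> I01" for x using that conj_image by blast
  have ne: "h x \<noteq> h y" if "x \<in> I01" "y \<in> I01" "x \<noteq> y" for x y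
    using conj_inj that by (meson inj_onD)
  \<comment> \<open>A continuous injection is monotone, and the comparison with \<open>h 0\<close>
    decides the direction.\<close>
  have between: "(h 0 < h x \<and> h x < h y) \<or> (h y < h x \<and> h x < h 0)" if "0 < x" "x < y" "y \<le> 1" for x y
    by (rule continuous_inj_imp_mono) 
      (use that in \<open>auto intro: continuous_on_subset[OF conj_cont] inj_on_subset[OF conj_inj]\<close>)
  have fix01: "h 0 = 0 \<or> h 0 = 1"
  proof -
    have "g (h 0) = h 0" using conj_eq[of 0] f by simp
    then show ?thesis using g(3)[of "h 0"] hI[of 0] by fastforce
  qed
  have "h 0 \<noteq> 1"
  proof
    assume h0: "h 0 = 1"
    have x: "f (1/2) < 1/2" "0 \<le> f (1/2)" using f(3)[of "1/2"] fI by (auto simp: image_subset_iff)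
    have hx: "h (1/2) \<in> I01" "h (1/2) \<noteq> 1" using hI[of "1/2"] ne[of "1/2" 0] h0 by auto
    have "h (1/2) < h (f (1/2))"
    proof (cases "f (1/2) = 0")
      case True
      then show ?thesis using hx h0 by auto
    next
      case False
      then show ?thesis using between[of "f (1/2)" "1/2"] x h0 hI[of "f (1/2)"] by auto
    qed
    moreover have "h (f (1/2)) = g (h (1/2))" using conj_eq[of "1/2"] by simp
    moreover have "g (h (1/2)) \<le> h (1/2)"
      using g(1) g(3)[of "h (1/2)"] hx by (cases "h (1/2) = 0") auto
    ultimately show False by simp
  qed
  then have h0: "h 0 = 0" using fix01 by simp
  show ?thesis
  proof (cases "x = 0")
    case True
    then show ?thesis using ne[of 0 y] hI[of y] xy h0 by force
  next
    case False
    then show ?thesis using between[of x y] xy h0 hI[of x] by auto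
  qed
qed

end

section \<open>Marked blocks and the recovery of the encoded sequence\<close>

locale marked_seq = block_seq X \<kappa> for X \<kappa> +
  fixes idx :: "nat \<Rightarrow> nat" and s :: "nat \<Rightarrow> bool"
  assumes idx: "strict_mono idx" and marked: "\<kappa> (idx S) = mark (s S)"
    and unmarked: "j \<notin> range idx \<Longrightarrow> nonflat 1 (\<kappa> j)"
begin

text \<open>The height 1/2 of the mark, measured from \<open>X (idx S)\<close> and lowered by the
  translation by -1.\<close>

definition flat_val :: "nat \<Rightarrow> real" where "flat_val S = logi (X (idx S) - 1 / 2)"

lemma flat_val_mem: "flat_val S \<in> I01"
  using logi_range[of "X (idx S) - 1 / 2"] by (simp add: flat_val_def)

lemma strict_mono_flat_val: "strict_mono flat_val"
proof (rule strict_monoI)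
  fix m n :: nat assume "m < n"
  then have "idx m < idx n" using idx by (simp add: strict_mono_less)
  then show "flat_val m < flat_val n" using gap[of "idx m" "idx n"] by (simp add: flat_val_def)
qed

text \<open>Outside the blocks the value would require \<open>t = X j + 1 / 2\<close>, which is
  inside block \<open>j\<close>; another block \<open>k\<close> has its image in
  \<open>{X k - 1..X k}\<close>, which the gap separates from \<open>X j - 1 / 2\<close>.\<close>

lemma line_map_half_level:
  "line_map 0 t = X j - 1 / 2 \<longleftrightarrow> X j \<le> t \<and> t \<le> X j + 1 \<and> \<kappa> j (t - X j) = 1 / 2"
proof
  assume eq: "line_map 0 t = X j - 1 / 2"
  show "X j \<le> t \<and> t \<le> X j + 1 \<and> \<kappa> j (t - X j) = 1 / 2"
  proof (cases rule: line_map_cases[of 0 t])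
    case (block k)
    have "X k - 1 \<le> X j - 1 / 2" "X j - 1 / 2 \<le> X k"
      using line_map_block_range[OF block(1-3)] eq by auto
    then have "k = j" using gap[of k j] gap[of j k] by (cases k j rule: linorder_cases) auto
    then show ?thesis using block eq by auto
  next
    case off
    then show ?thesis using off(1)[of j] eq by auto
  qed
qed (use line_map_block[of 0 j t] in auto)

lemma flat_val_flat: "flat_val S \<in> flat_vals unit_map"
proof -
  let ?A = "{X (idx S) + 1 / 2..X (idx S) + 2 / 3}"
  have "connected (logi ` ?A)" by (intro connected_continuous_image continuous_logi) simp
  moreover have "logi ` ?A \<subseteq> I01" using less_imp_le[OF logi_range(1)] less_imp_le[OF logi_range(2)] by auto
  moreover have "logi (X (idx S) + 1 / 2) \<noteq> logi (X (idx S) + 2 / 3)"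
    by (rule less_imp_neq) simp
  moreover have "unit_map x = flat_val S" if "x \<in> logi ` ?A" for x
  proof -
    obtain t where t: "t \<in> ?A" "x = logi t" using \<open>x \<in> _\<close> by blast
    then have "line_map 0 t = X (idx S) - 1 / 2"
      using mark_flat[of "t - X (idx S)" "s S"] by (subst line_map_half_level) (auto simp: marked)
    then show ?thesis using t by (simp add: unit_map_logi flat_val_def)
  qed
  moreover have "logi (X (idx S) + 1 / 2) \<in> logi ` ?A" "logi (X (idx S) + 2 / 3) \<in> logi ` ?A" by auto
  ultimately show ?thesis unfolding flat_vals_def by blast
qed

text \<open>The translation is injective, so an interval of constancy must begin inside a block;
  there the profile is constant on an interval, hence it is a mark at height 1/2.\<close>

lemma line_map_const:
  assumes uv: "u < v" and const: "\<And>t. t \<in> {u..v} \<Longrightarrow> line_map 0 t = z"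
  shows "\<exists>S. z = X (idx S) - 1 / 2"
proof -
  \<comment> \<open>The right end of a block counts as outside, since the map is the translation
    there too; two distinct such points have distinct images.\<close>
  have noff: "\<exists>j. X j \<le> t \<and> t \<le> X j + 1" if "t \<in> {u..v}" "t' \<in> {u..v}" "t \<noteq> t'" 
    "\<And>j. t' < X j \<or> X j + 1 < t' \<or> t' = X j + 1" for t t'
  proof (rule ccontr)
    assume "\<not> ?thesis"
    then have "line_map 0 t = t - 1" by (intro line_map_off) (meson not_le)
    moreover have "line_map 0 t' = t' - 1"
    proof (cases rule: line_map_cases[of 0 t'])
      case (block j)
      then show ?thesis using that(4)[of j] by (auto simp: \<kappa>_ends)
    qed simp
    ultimately show False using const that by simp
  qed
  have "\<exists>j. X j \<le> u \<and> u < X j + 1"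
  proof (rule ccontr)
    assume "\<not> ?thesis"
    then have off: "u < X j \<or> X j + 1 < u \<or> u = X j + 1" for j by (meson not_less_iff_gr_or_eq not_le)
    have ex: "\<exists>j. u < X j"
    proof -
      obtain n where "u < real n" using reals_Archimedean2 by blast
      then show ?thesis using big[of n] by (intro exI[of _ n]) auto
    qed
    \<comment> \<open>A point \<open>t\<close> is taken to the right of \<open>u\<close> but below
      the next block start; a block containing \<open>t\<close> then starts at or below
      \<open>u\<close> and contains \<open>u\<close> before its right end.\<close>
    define j where "j = (LEAST j. u < X j)"
    have j: "u < X j" unfolding j_def by (rule LeastI_ex[OF ex])
    define t where "t = min v ((u + X j) / 2)"
    have t: "u < t" "t \<in> {u..v}" "t < X j" using uv j by (auto simp: t_def min_def)
    obtain k where k: "X k \<le> t" "t \<le> X k + 1" using noff[of t u] t off uv by auto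
    have "k < j" using mono_X[of j k] k t by (auto intro: ccontr)
    then have "X k \<le> u" using not_less_Least unfolding j_def by (metis not_less)
    then show False using off[of k] k t by auto
  qed
  then obtain j where j: "X j \<le> u" "u < X j + 1" by blast
  define w where "w = min v (X j + 1)"
  have c: "\<kappa> j r = z - X j + 1" if "r \<in> {u - X j..w - X j}" for r
    using line_map_block[of 0 j "r + X j"] const[of "r + X j"] that j by (auto simp: w_def)
  have r: "0 \<le> u - X j" "u - X j < w - X j" "w - X j \<le> 1" using j uv by (auto simp: w_def)
  have "\<not> nonflat 1 (\<kappa> j)"
  proof
    assume "nonflat 1 (\<kappa> j)"
    from nonflat_obtain_less[OF this r] obtain p q
      where "p \<in> {u - X j..w - X j}" "q \<in> {u - X j..w - X j}" "\<kappa> j p \<noteq> \<kappa> j q" by blast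
    then show False using c[of p] c[of q] by simp
  qed
  then obtain S where S: "j = idx S" using unmarked by blast
  have "z - X j + 1 = 1 / 2"
    by (rule mark_flat_only[OF r, of "s S"]) (use c marked S in auto)
  then show ?thesis using S by (intro exI[of _ S]) simp
qed

lemma flat_vals_unit_map: "flat_vals unit_map = range flat_val"
proof (intro subset_antisym subsetI)
  fix y assume "y \<in> flat_vals unit_map"
  then obtain C p q where C0: "C \<subseteq> I01" "connected C" "p \<in> C" "q \<in> C" "p \<noteq> q" "\<forall>x\<in>C. unit_map x = y"
    unfolding flat_vals_def by blast
  define a b where "a = min p q" and "b = max p q"
  have C: "C \<subseteq> I01" "connected C" "a \<in> C" "b \<in> C" "a < b" "\<forall>x\<in>C. unit_map x = y"
    using C0 by (auto simp: a_def b_def min_def max_def)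
  have sub: "{a..b} \<subseteq> C" using C connected_contains_Icc by blast
  \<comment> \<open>The middle third avoids the ends 0 and 1, so that \<open>logit\<close> can be
    applied.\<close>
  define c d where "c = (2 * a + b) / 3" and "d = (a + 2 * b) / 3"
  have cd: "a < c" "c < d" "d < b" "0 \<le> a" "b \<le> 1" using C by (auto simp: c_def d_def)
  have lc: "logi (logit c) = c" "logi (logit d) = d" using cd by (auto intro!: logi_logit)
  have flat_val: "y = logi (line_map 0 t)" if "t \<in> {logit c..logit d}" for t
  proof -
    have "c \<le> logi t" "logi t \<le> d" using that lc logi_le_iff by (metis atLeastAtMost_iff)+
    then have "logi t \<in> C" using sub cd by auto
    then show ?thesis using C(6) unit_map_logi[of t] by simp
  qed
  have lt: "logit c < logit d" using cd(2) lc logi_less_iff by metis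
  have "line_map 0 t = line_map 0 (logit c)" if "t \<in> {logit c..logit d}" for t
    using flat_val[OF that] flat_val[of "logit c"] lt by (metis atLeastAtMost_iff less_imp_le logit_logi order_refl)
  from line_map_const[OF lt this] obtain S where "line_map 0 (logit c) = X (idx S) - 1 / 2" by blast
  then show "y \<in> range flat_val" using flat_val[of "logit c"] lt by (auto simp: flat_val_def)
qed (use flat_val_flat in blast)

lemma level_unit_map: "level unit_map (flat_val S) = logi ` {t. line_map 0 t = X (idx S) - 1 / 2}"
proof (intro subset_antisym subsetI)
  fix x assume x: "x \<in> level unit_map (flat_val S)"
  then have "x \<in> I01" by (simp add: level_def)
  then show "x \<in> logi ` {t. line_map 0 t = X (idx S) - 1 / 2}"
  proof (cases rule: I01_cases)
    case (3 t)
    then have "logi (line_map 0 t) = logi (X (idx S) - 1 / 2)" using x by (simp add: level_def unit_map_logi flat_val_def)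
    then have "line_map 0 t = X (idx S) - 1 / 2" by (metis logit_logi)
    then show ?thesis using 3 by blast
  qed (use x logi_range[of "X (idx S) - 1 / 2"] in \<open>auto simp: level_def flat_val_def\<close>)
next
  fix x assume "x \<in> logi ` {t. line_map 0 t = X (idx S) - 1 / 2}"
  then show "x \<in> level unit_map (flat_val S)"
    using logi_range by (auto simp: level_def unit_map_logi flat_val_def less_imp_le)
qed

text \<open>For \<open>True\<close>, the positions 1/6 and 1/2 of the block belong to the level but
  1/4 between them does not; for \<open>False\<close> the level is the image of one
  interval.\<close>

lemma connected_level: "connected (level unit_map (flat_val S)) \<longleftrightarrow> \<not> s S"
proof (cases "s S")
  case False
  have "{t. line_map 0 t = X (idx S) - 1 / 2} = {X (idx S) + 1 / 3..X (idx S) + 2 / 3}"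
    using mark_False_level[of "t - X (idx S)" for t] False by (auto simp: line_map_half_level marked)
  then show ?thesis
    using False by (simp add: level_unit_map connected_continuous_image continuous_logi)
next
  case True
  let ?x = "\<lambda>u. logi (X (idx S) + u)"
  have lev: "?x u \<in> level unit_map (flat_val S) \<longleftrightarrow> mark True u = 1 / 2" if "0 \<le> u" "u \<le> 1" for u
  proof -
    have "?x u \<in> level unit_map (flat_val S) \<longleftrightarrow> line_map 0 (X (idx S) + u) = X (idx S) - 1 / 2"
      unfolding level_unit_map by (auto dest: arg_cong[of _ _ logit])
    then show ?thesis using that True by (simp add: line_map_half_level marked)
  qed
  have "\<not> connected (level unit_map (flat_val S))"
  proof
    assume "connected (level unit_map (flat_val S))"
    moreover have "?x (1/6) \<in> level unit_map (flat_val S)" "?x (1/2) \<in> level unit_map (flat_val S)"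
      using lev[of "1/6"] lev[of "1/2"] mark_True_level by auto
    ultimately have "{?x (1/6)..?x (1/2)} \<subseteq> level unit_map (flat_val S)" by (rule connected_contains_Icc)
    then have "?x (1/4) \<in> level unit_map (flat_val S)" by auto
    then show False using lev[of "1/4"] mark_True_level by auto
  qed
  then show ?thesis using True by simp
qed

end

text \<open>The conjugacy is increasing and carries the flat values of one map onto those of the
  other, hence the \<open>S\<close>-th to the \<open>S\<close>-th; it preserves connectedness of
  their levels, which encodes the sequences.\<close>

lemma marked_conjugate:
  assumes "marked_seq X \<kappa> idx s" "marked_seq X' \<kappa>' idx' s'"
    and conj: "conjugate_on I01 (block_seq.unit_map X \<kappa>) (block_seq.unit_map X' \<kappa>')"
  shows "s = s'"
proof -
  interpret A: marked_seq X \<kappa> idx s by fact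
  interpret B: marked_seq X' \<kappa>' idx' s' by fact
  obtain h h' where hom: "homeomorphism I01 I01 h h'" and eq: "\<And>x. x \<in> I01 \<Longrightarrow> B.unit_map x = h (A.unit_map (h' x))"
    using conj unfolding conjugate_on_def by blast
  have AI: "A.unit_map ` I01 \<subseteq> I01" and BI: "B.unit_map ` I01 \<subseteq> I01" using A.unit_map_mem B.unit_map_mem by blast+
  have hom': "homeomorphism I01 I01 h' h" using hom by (rule homeomorphism_symD)
  have inv: "\<And>x. x \<in> I01 \<Longrightarrow> h (h' x) = x" "\<And>x. x \<in> I01 \<Longrightarrow> h' (h x) = x"
    "\<And>x. x \<in> I01 \<Longrightarrow> h x \<in> I01" "\<And>x. x \<in> I01 \<Longrightarrow> h' x \<in> I01"
    using hom unfolding homeomorphism_def by auto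
  have eq': "A.unit_map x = h' (B.unit_map (h x))" if "x \<in> I01" for x
    using eq[OF inv(3)[OF that]] inv(2) that A.unit_map_mem[OF that] by (simp add: inv(2)[OF that] del: atLeastAtMost_iff)
  note mono = conj_strict_mono[OF hom eq AI A.unit_map_ends A.unit_map_less B.unit_map_ends B.unit_map_less]
  have "strict_mono (h \<circ> A.flat_val)"
    by (rule strict_monoI) (auto intro!: mono A.flat_val_mem simp: strict_mono_less[OF A.strict_mono_flat_val] simp del: atLeastAtMost_iff)
  moreover have "range (h \<circ> A.flat_val) = range B.flat_val"
  proof -
    have "h ` range A.flat_val \<subseteq> range B.flat_val"
      using flat_vals_conj[OF hom eq AI] by (simp add: A.flat_vals_unit_map B.flat_vals_unit_map)
    moreover have "range B.flat_val \<subseteq> h ` range A.flat_val"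
    proof
      fix y assume y: "y \<in> range B.flat_val"
      have "h' ` range B.flat_val \<subseteq> range A.flat_val"
        using flat_vals_conj[OF hom' eq' BI] by (simp add: A.flat_vals_unit_map B.flat_vals_unit_map)
      then have "h' y \<in> range A.flat_val" using y by blast
      moreover have "y \<in> I01" using y B.flat_val_mem by (auto simp del: atLeastAtMost_iff)
      ultimately show "y \<in> h ` range A.flat_val" using inv(1)[of y] by (metis imageI)
    qed
    ultimately show ?thesis by (simp only: image_comp[symmetric])
  qed
  ultimately have flat_val: "h (A.flat_val S) = B.flat_val S" for S
    using strict_mono_range_eq[OF _ B.strict_mono_flat_val, of "h \<circ> A.flat_val" S] by simp
  show ?thesis
  proof
    fix S
    have "connected (level A.unit_map (A.flat_val S)) \<longleftrightarrow> connected (level B.unit_map (B.flat_val S))"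
    proof
      assume "connected (level A.unit_map (A.flat_val S))"
      from connected_level_conj[OF hom eq AI A.flat_val_mem this] show "connected (level B.unit_map (B.flat_val S))"
        by (simp add: flat_val)
    next
      assume "connected (level B.unit_map (B.flat_val S))"
      from connected_level_conj[OF hom' eq' BI B.flat_val_mem this] show "connected (level A.unit_map (A.flat_val S))"
        by (simp add: flat_val[symmetric] inv(2)[OF A.flat_val_mem])
    qed
    then show "s S = s' S" by (simp add: A.connected_level B.connected_level)
  qed
qed

section \<open>The stagewise construction\<close>

text \<open>The conditions of \<open>block_seq\<close> for an initial segment; later entries are
  arbitrary.\<close>

definition valid :: "nat \<Rightarrow> (nat \<Rightarrow> real \<times> (real \<Rightarrow> real)) \<Rightarrow> bool" where
  "valid a B \<longleftrightarrow> (\<forall>j<a. profile (snd (B j)) \<and> real j \<le> fst (B j) \<and> (\<forall>i<j. fst (B i) + 3 \<le> fst (B j)))"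

text \<open>A stage reads only the first \<open>p + n\<close> entries; \<open>0 < n\<close> makes
  the entry \<open>p\<close>, whose position occurs in it, one of them.\<close>

lemma crooked_stage_cong:
  assumes "crooked_stage S p n B" "\<And>j. j < p + n \<Longrightarrow> B' j = B j" "0 < n"
  shows "crooked_stage S p n B'"
proof -
  have "block_product B' p n = block_product B p n" by (rule block_product_cong) (use assms in \<open>auto intro: exI[of _ 0]\<close>)
  moreover have "half_product B' 0 p = half_product B 0 p" by (rule half_product_cong) (use assms in auto)
  moreover have "B' p = B p" using assms by auto
  ultimately show ?thesis using assms(1) by (simp add: crooked_stage_def)
qed

text \<open>First the marked block is added, then \<open>e\<close> is fixed by the uniform
  continuity of all blocks so far, and only then a composition crooked at scale \<open>e\<close> is
  chosen and moved above everything.\<close>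

lemma extend_stage:
  assumes v: "valid a B"
  obtains a' B' where "valid a' B'" "Suc a < a'" "\<And>j. j < a \<Longrightarrow> B' j = B j" "snd (B' a) = mark b"
    "\<And>j. a < j \<Longrightarrow> j < a' \<Longrightarrow> nonflat 1 (snd (B' j))" "crooked_stage S (Suc a) (a' - Suc a) B'"
proof -
  define c where "c = Max (insert 0 ((\<lambda>j. fst (B j)) ` {..<a}))"
  have c: "0 \<le> c" "\<And>j. j < a \<Longrightarrow> fst (B j) \<le> c" by (auto simp: c_def)
  define x where "x = max (c + 3) (real a)"
  define B1 where "B1 = B(a := (x, mark b))"
  define p where "p = Suc a"
  have v1: "valid p B1"
    unfolding valid_def
  proof (intro allI impI)
    fix j assume "j < p"
    then consider "j < a" | "j = a" by (auto simp: p_def less_Suc_eq)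
    then show "profile (snd (B1 j)) \<and> real j \<le> fst (B1 j) \<and> (\<forall>i<j. fst (B1 i) + 3 \<le> fst (B1 j))"
    proof cases
      case 1 then show ?thesis using v by (auto simp: B1_def valid_def)
    next
      case 2 then show ?thesis using c(2) profile_mark by (fastforce simp: B1_def x_def)
    qed
  qed
  have x1: "fst (B1 j) \<le> x" if "j < p" for j
    using that c(2)[of j] by (cases "j = a") (auto simp: B1_def x_def p_def)
  \<comment> \<open>One more than the range in \<open>crooked_stage\<close>, so that points at
    distance less than \<open>e \<le> 1\<close> stay inside.\<close>
  define K where "K = real S + real p + 1"
  have "uniformly_continuous_on {-K..K} (half_product B1 0 p)"
    by (intro compact_uniformly_continuous continuous_half_product) (use v1 in \<open>auto simp: valid_def\<close>)
  moreover have "0 < 1 / (real S + 1)" by simp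
  ultimately obtain e' where e': "0 < e'"
    "\<And>s t. s \<in> {-K..K} \<Longrightarrow> t \<in> {-K..K} \<Longrightarrow> dist t s < e' \<Longrightarrow> dist (half_product B1 0 p t) (half_product B1 0 p s) < 1 / (real S + 1)"
    unfolding uniformly_continuous_on_def by metis
  define e where "e = min e' 1"
  have e: "0 < e" "e \<le> 1" "e \<le> e'" using e' by (auto simp: e_def)
  have md: "\<bar>half_product B1 0 p s - half_product B1 0 p t\<bar> < 1 / (real S + 1)"
    if "\<bar>s\<bar> \<le> real S + real p" "\<bar>s - t\<bar> < e" for s t
  proof -
    have "s \<in> {-K..K}" "t \<in> {-K..K}" "dist s t < e'" using that e by (auto simp: K_def dist_real_def)
    from e'(2)[OF this(2,1,3)] show ?thesis by (simp add: dist_real_def)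
  qed
  obtain U where U: "block_comp U" "\<And>c d. \<bar>U c - U d\<bar> \<le> 2 * (real S + real p) \<Longrightarrow> crooked_pair e U c d"
    using crooked_block_comp[of "2 * (real S + real p)" e] e by auto
  obtain n B0 where B0: "\<And>j. j < n \<Longrightarrow> good_profile (snd (B0 j))" "U = block_product B0 0 n"
    using U(1) unfolding block_comp_def by blast
  have n: "0 < n"
  proof (rule ccontr)
    assume "\<not> 0 < n"
    then have "U = id" using B0 by simp
    then have "crooked_pair e id 0 2" using U(2)[of 0 2] by (simp add: p_def)
    then show False by (rule crooked_pair_ordered) (use e in auto)
  qed
  define C where "C = max (x + 3) (real S + real p + 2 * real n + 1)"
  \<comment> \<open>Each block is moved up by an integer, which leaves the block product unchanged;
    the spacing 4 with a rounding error below 1 gives the gap 3.\<close>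
  define y where "y j = fst (B0 j) + of_int \<lceil>C + 4 * real j - fst (B0 j)\<rceil>" for j
  have y: "C + 4 * real j \<le> y j" "y j < C + 4 * real j + 1" for j
    unfolding y_def by linarith+
  define B2 where "B2 j = (if j < p then B1 j else (y (j - p), snd (B0 (j - p))))" for j
  have B2: "B2 (p + j) = (y j, snd (B0 j))" for j by (simp add: B2_def)
  have B21: "B2 j = B1 j" if "j < p" for j using that by (simp add: B2_def)
  have PR2: "block_product B2 p n = U"
    unfolding B0(2) by (rule block_product_cong) (auto simp: B2 y_def)
  have half2: "half_product B2 0 p = half_product B1 0 p" by (rule half_product_cong) (simp add: B21)
  have v2: "valid (p + n) B2"
    unfolding valid_def
  proof (intro allI impI)
    fix j assume j: "j < p + n"
    show "profile (snd (B2 j)) \<and> real j \<le> fst (B2 j) \<and> (\<forall>i<j. fst (B2 i) + 3 \<le> fst (B2 j))"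
    proof (cases "j < p")
      case True
      then show ?thesis using v1 by (simp add: valid_def B2_def)
    next
      case False
      then obtain k where k: "j = p + k" "k < n" using j by (metis le_Suc_ex nat_add_left_cancel_less not_less)
      have "fst (B2 i) + 3 \<le> y k" if i: "i < j" for i
      proof (cases "i < p")
        case True
        then show ?thesis using x1[OF True] y(1)[of k] by (simp add: B21 C_def)
      next
        case False
        then obtain l where l: "i = p + l" "l < k" using i k by (metis le_Suc_ex nat_add_left_cancel_less not_less)
        then have "real l + 1 \<le> real k" by simp
        then show ?thesis using y(2)[of l] y(1)[of k] l by (simp add: B2)
      qed
      moreover have "real j \<le> y k" using y(1)[of k] k by (simp add: C_def)
      ultimately show ?thesis using B0(1)[OF k(2)] by (simp add: k B2 good_profile_def)
    qed
  qed
  have stage: "crooked_stage S p n B2"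
  proof -
    have "real S + real p + 2 * real n + 1 \<le> fst (B2 p)" using B2[of 0] y(1)[of 0] by (simp add: C_def)
    then show ?thesis unfolding crooked_stage_def PR2 half2 using e U(2) md by blast
  qed
  show ?thesis
  proof (rule that[of "p + n" B2])
    show "B2 j = B j" if "j < a" for j using that by (simp add: B2_def B1_def p_def)
    show "snd (B2 a) = mark b" by (simp add: B2_def B1_def p_def)
    show "nonflat 1 (snd (B2 j))" if "a < j" "j < p + n" for j
      using that B0(1)[of "j - p"] by (simp add: B2_def p_def good_profile_def)
    show "crooked_stage S (Suc a) (p + n - Suc a) B2" using stage by (simp add: p_def)
  qed (use v2 n in \<open>simp_all add: p_def\<close>)
qed

lemma marked_seq_exists:
  obtains X \<kappa> idx where "marked_seq X \<kappa> idx s" "crooked (block_seq.unit_map X \<kappa>)"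
proof -
  define Q where "Q S st st' \<longleftrightarrow> Suc (fst st) < fst st' \<and> (\<forall>j<fst st. snd st' j = snd st j) \<and>
     snd (snd st' (fst st)) = mark (s S) \<and> (\<forall>j. fst st < j \<longrightarrow> j < fst st' \<longrightarrow> nonflat 1 (snd (snd st' j))) \<and>
     crooked_stage S (Suc (fst st)) (fst st' - Suc (fst st)) (snd st')"
    for S :: nat and st st' :: "nat \<times> (nat \<Rightarrow> real \<times> (real \<Rightarrow> real))"
  \<comment> \<open>The clause for \<open>S = 0\<close> starts the construction with no blocks, so
    that every index is placed by some stage.\<close>
  have "\<exists>st. \<forall>S. (valid (fst (st S)) (snd (st S)) \<and> (S = 0 \<longrightarrow> fst (st S) = 0)) \<and> Q S (st S) (st (Suc S))"
  proof (rule dependent_nat_choice)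
    show "\<exists>st. valid (fst st) (snd st) \<and> (0 = (0::nat) \<longrightarrow> fst st = 0)"
      by (intro exI[of _ "(0, undefined)"]) (simp add: valid_def)
    fix st :: "nat \<times> (nat \<Rightarrow> real \<times> (real \<Rightarrow> real))" and S :: nat
    assume "valid (fst st) (snd st) \<and> (S = 0 \<longrightarrow> fst st = 0)"
    then have "valid (fst st) (snd st)" by simp
    from extend_stage[OF this, of "s S" S] obtain a' B' where *: "valid a' B'" "Suc (fst st) < a'"
      "\<And>j. j < fst st \<Longrightarrow> B' j = snd st j" "snd (B' (fst st)) = mark (s S)"
      "\<And>j. fst st < j \<Longrightarrow> j < a' \<Longrightarrow> nonflat 1 (snd (B' j))"
      "crooked_stage S (Suc (fst st)) (a' - Suc (fst st)) B'" by blast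
    then show "\<exists>st'. (valid (fst st') (snd st') \<and> (Suc S = 0 \<longrightarrow> fst st' = 0)) \<and> Q S st st'"
      by (intro exI[of _ "(a', B')"]) (simp add: Q_def)
  qed
  then obtain st where st: "\<And>S. valid (fst (st S)) (snd (st S))" "\<And>S. Q S (st S) (st (Suc S))"
    and st0: "fst (st 0) = 0" by blast
  define a where "a S = fst (st S)" for S
  define A where "A S = snd (st S)" for S
  have va: "valid (a S) (A S)" for S using st(1) by (simp add: a_def A_def)
  have a_Suc: "Suc (a S) < a (Suc S)" and A_Suc: "\<And>j. j < a S \<Longrightarrow> A (Suc S) j = A S j"
    and A_mark: "snd (A (Suc S) (a S)) = mark (s S)"
    and A_nonflat: "\<And>j. a S < j \<Longrightarrow> j < a (Suc S) \<Longrightarrow> nonflat 1 (snd (A (Suc S) j))"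
    and A_stage: "crooked_stage S (Suc (a S)) (a (Suc S) - Suc (a S)) (A (Suc S))" for S
    using st(2)[of S] unfolding Q_def a_def A_def by blast+
  have a_mono: "strict_mono a"
    using a_Suc by (intro strict_mono_Suc_iff[THEN iffD2] allI) (meson Suc_lessD)
  have a_ge: "S \<le> a S" for S by (rule strict_mono_imp_increasing[OF a_mono])
  have A_le: "A T j = A S j" if "S \<le> T" "j < a S" for S T j
    using that(1)
  proof (induction T rule: dec_induct)
    case (step T)
    have "a S \<le> a T" using step a_mono by (simp add: strict_mono_less_eq)
    then show ?case using A_Suc[of j T] step that by simp
  qed simp
  \<comment> \<open>Entry \<open>j\<close> is final from stage \<open>Suc j\<close> on, since
    \<open>j < a (Suc j)\<close>.\<close>
  define B where "B j = A (Suc j) j" for j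
  have B: "B j = A S j" if "j < a S" for j S
  proof -
    have "j < a (Suc j)" using a_ge[of "Suc j"] by simp
    then show ?thesis using A_le[of "Suc j" S j] A_le[of S "Suc j" j] that unfolding B_def
      by (cases "S \<le> Suc j") auto
  qed
  define X \<kappa> where "X j = fst (B j)" and "\<kappa> j = snd (B j)" for j
  have BX: "(\<lambda>j. (X j, \<kappa> j)) = B" by (simp add: X_def \<kappa>_def)
  have vB: "profile (snd (B j)) \<and> real j \<le> fst (B j) \<and> (\<forall>i<j. fst (B i) + 3 \<le> fst (B j))" for j
  proof -
    have j: "j < a (Suc j)" using a_ge[of "Suc j"] by simp
    have "B i = A (Suc j) i" if "i \<le> j" for i using that j B[of i "Suc j"] by simp
    then show ?thesis using va[of "Suc j"] j by (simp add: valid_def)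
  qed
  interpret marked_seq X \<kappa> a s
  proof
    show "profile (\<kappa> j)" "real j \<le> X j" for j using vB by (auto simp: X_def \<kappa>_def)
    show "X i + 3 \<le> X j" if "i < j" for i j using vB that by (auto simp: X_def)
    show "strict_mono a" by (rule a_mono)
    show "\<kappa> (a S) = mark (s S)" for S
      using A_mark[of S] B[of "a S" "Suc S"] a_Suc[of S] by (simp add: \<kappa>_def)
    show "nonflat 1 (\<kappa> j)" if j: "j \<notin> range a" for j
    proof -
      \<comment> \<open>The index lies strictly between \<open>a S\<close> and
        \<open>a (Suc S)\<close>, where \<open>S\<close> is the last stage that has not yet placed
        it.\<close>
      define T where "T = (LEAST T. j < a T)"
      have ex: "j < a (Suc j)" using a_ge[of "Suc j"] by simp
      have T: "j < a T" unfolding T_def by (rule LeastI[of "\<lambda>T. j < a T", OF ex])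
      have "T \<noteq> 0"
      proof
        assume "T = 0"
        then show False using T st0 by (simp add: a_def)
      qed
      then obtain S where S: "T = Suc S" by (cases T) auto
      have "\<not> j < a S" using not_less_Least[of S "\<lambda>T. j < a T"] S unfolding T_def by simp
      then have "a S < j" using j by (metis linorder_neqE_nat rangeI)
      then show ?thesis using A_nonflat[of S j] T B[of j T] S by (simp add: \<kappa>_def)
    qed
  qed
  have "crooked unit_map"
  proof (rule crooked_unit_map)
    fix S :: nat
    define p n where "p = Suc (a S)" and "n = a (Suc S) - Suc (a S)"
    have "crooked_stage S p n B"
      by (rule crooked_stage_cong[of _ _ _ "A (Suc S)"])
        (use A_stage[of S] a_Suc[of S] B[of _ "Suc S"] in \<open>auto simp: p_def n_def\<close>)
    then show "\<exists>p n. crooked_stage S p n (\<lambda>j. (X j, \<kappa> j))" unfolding BX by blast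
  qed
  then show ?thesis using that marked_seq_axioms by blast
qed

lemma conjugate_on_refl: "conjugate_on X f f"
  unfolding conjugate_on_def by (intro exI[of _ id]) (auto simp: homeomorphism_def id_def)

theorem corollary4p12:
  "\<exists>F :: (real \<Rightarrow> real) set.
     uncountable F \<and>
     (\<forall>f\<in>F. interval_map f \<and> crooked f \<and> top_entropy I01 f = 0 \<and>
        card {x \<in> I01. f x = x} = 2) \<and>
     pairwise (\<lambda>f g. \<not> conjugate_on I01 f g) F"
proof -
  have "\<exists>X \<kappa> idx. marked_seq X \<kappa> idx s \<and> crooked (block_seq.unit_map X \<kappa>)" for s
    by (rule marked_seq_exists[of s]) blast
  then obtain X \<kappa> idx where seq: "\<And>s. marked_seq (X s) (\<kappa> s) (idx s) s"
    and crooked: "\<And>s. crooked (block_seq.unit_map (X s) (\<kappa> s))" by metis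
  define f where "f s = block_seq.unit_map (X s) (\<kappa> s)" for s
  have conj: "s = s'" if "conjugate_on I01 (f s) (f s')" for s s'
    using marked_conjugate[OF seq seq] that unfolding f_def by blast
  \<comment> \<open>Equal maps are conjugate, so distinct sequences give distinct maps.\<close>
  have "inj f"
  proof (rule injI)
    fix s s' assume "f s = f s'"
    then have "conjugate_on I01 (f s) (f s')" using conjugate_on_refl[of I01 "f s"] by simp
    then show "s = s'" by (rule conj)
  qed
  moreover have "uncountable (UNIV :: (nat \<Rightarrow> bool) set)"
  proof
    assume c: "countable (UNIV :: (nat \<Rightarrow> bool) set)"
    define g where "g = from_nat_into (UNIV :: (nat \<Rightarrow> bool) set)"
    have "range g = UNIV" unfolding g_def by (rule range_from_nat_into) (use c in auto)
    \<comment> \<open>Cantor's diagonal sequence.\<close>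
    then have "(\<lambda>k. \<not> g k k) \<in> range g" by simp
    then obtain n where "(\<lambda>k. \<not> g k k) = g n" by (rule rangeE)
    from fun_cong[OF this, of n] show False by simp
  qed
  ultimately have "uncountable (range f)" by (simp add: countable_image_inj_eq)
  moreover have "interval_map (f s) \<and> crooked (f s) \<and> top_entropy I01 (f s) = 0 \<and> card {x \<in> I01. f s x = x} = 2" for s
  proof -
    interpret marked_seq "X s" "\<kappa> s" "idx s" s by (rule seq)
    show ?thesis using interval_map_unit_map crooked top_entropy_unit_map card_fix_unit_map unfolding f_def by blast
  qed
  moreover have "pairwise (\<lambda>f g. \<not> conjugate_on I01 f g) (range f)"
    using conj by (auto simp: pairwise_def)
  ultimately show ?thesis by (intro exI[of _ "range f"]) auto
qed

end
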